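(* Let $(X,\mathcal R)$ and $(Y,\mathcal S)$ be exactly triply regular symmetric $d$-class association schemes having the same Delta–Wye parameters with respect to orderings $A_0,\dots,A_d$, $A'_0,\dots,A'_d$ of their adjacency matrices and $E_0,\dots,E_d$, $E'_0,\dots,E'_d$ of their primitive idempotents, and let $\kappa:\mathbb A\to\mathbb A'$ be the linear map with $\kappa(A_i)=A'_i$ for $0\le i\le d$. Let $F$ be a connected planar graph, possibly with loops and multiple edges, and let $w:E(F)\to\mathbb A$ be any function. Then $$\mathsf S(F,\emptyset;w)=\mathsf S(F,\emptyset;\kappa\circ w).$$
   Context: A symmetric $d$-class association scheme $(X,\mathcal R)$ consists of a finite nonempty set $X$ and a partition $\mathcal R=\{R_0,\dots,R_d\}$ of $X\times X$ into nonempty symmetric relations, with $R_0=\{(x,x):x\in X\}$, such that for all $i,j,k$ the number $p_{ij}^k=|\{z\in X:(x,z)\in R_i,(z,y)\in R_j\}|$ (the intersection numbers) does not depend on the choice of $(x,y)\in R_k$. The adjacency matrix $A_i\in\mathrm{Mat}_X(\mathbb C)$ is the $0/1$ matrix of $R_i$. The Bose–Mesner algebra $\mathbb A=\mathrm{span}\{A_0,\dots,A_d\}$ is commutative and closed under ordinary matrix product and under the entrywise (Schur) product $\circ$; it has a second basis of primitive idempotents $E_0,\dots,E_d$ (symmetric, $E_iE_j=\delta_{ij}E_i$, $\sum_j E_j=I$). Eigenvalues $P_{ji}$ and dual eigenvalues $Q_{ji}$ are defined by $A_i=\sum_j P_{ji}E_j$ and $E_i=|X|^{-1}\sum_j Q_{ji}A_j$,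 and Krein parameters $q_{ij}^k$ by $E_i\circ E_j=|X|^{-1}\sum_k q_{ij}^kE_k$. For $L,M,N\in\mathrm{Mat}_X(\mathbb C)$ define tensors in $(\mathbb C^X)^{\otimes 3}$ (with standard basis vectors $\hat x$, $x\in X$): $\Delta(L,M,N)=\sum_{x,y,z\in X}L_{xz}M_{xy}N_{yz}\,\hat x\otimes\hat y\otimes\hat z$ and $\Upsilon(L,M,N)=\sum_{x,y,z,u\in X}L_{xu}M_{yu}N_{zu}\,\hat x\otimes\hat y\otimes\hat z$. Let $\Delta(\mathbb A)$ and $\Upsilon(\mathbb A)$ be the spans of all $\Delta(L,M,N)$, resp. $\Upsilon(L,M,N)$, with $L,M,N\in\mathbb A$. The scheme is triply regular if $\Upsilon(\mathbb A)\subseteq\Delta(\mathbb A)$, dually triply regular if $\Delta(\mathbb A)\subseteq\Upsilon(\mathbb A)$, and exactly triply regular if both hold. It is known that the tensors $\Upsilon(E_r,E_s,E_t)$ with $q_{rs}^t>0$ form a basis of $\Upsilon(\mathbb A)$. Delta–Wye parameters: if the scheme is exactly triply regular, then for each $i,j,k\in\{0,\dots,d\}$ there are unique scalars $\sigma^{i,j,k}_{r,s,t}$ ($r,s,t$ with $q_{rs}^t>0$; set $\sigma^{i,j,k}_{r,s,t}=0$ when $q_{rs}^t=0$) such that $\Delta(A_i,A_j,A_k)=\sum_{q_{rs}^t>0}\sigma^{i,j,k}_{r,s,t}\,\Upsilon(E_r,E_s,E_t)$. Two exactly triply regular $d$-class schemes $(X,\mathcal R)$, $(Y,\mathcal S)$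 have the same Delta–Wye parameters if there are orderings $A_0,\dots,A_d$ and $A'_0,\dots,A'_d$ of their adjacency matrices and $E_0,\dots,E_d$ and $E'_0,\dots,E'_d$ of their primitive idempotents such that $\sigma^{i,j,k}_{r,s,t}$ computed in $(X,\mathcal R)$ equals the corresponding $\sigma^{i,j,k}_{r,s,t}$ computed in $(Y,\mathcal S)$ for all $i,j,k,r,s,t\in\{0,\dots,d\}$. $\mathbb A'$ denotes the Bose–Mesner algebra of $(Y,\mathcal S)$. Scaffold of order zero: for a finite graph $F$ (loops and multiple edges allowed) and $w:E(F)\to\mathrm{Mat}_X(\mathbb C)$ with symmetric values, $\mathsf S(F,\emptyset;w)=\sum_{\varphi:V(F)\to X}\prod_{e\in E(F)}w(e)_{\varphi(a_e),\varphi(b_e)}$, where $a_e,b_e$ are the ends of $e$ ($a_e=b_e$ for a loop). *)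

theory Defs
  imports "HOL-Analysis.Analysis" "HOL-Library.FuncSet"
begin

text \<open>Matrices indexed by a finite type 'x are functions 'x \<Rightarrow> 'x \<Rightarrow> complex;
  tensors in (C^X)^{\<otimes>3} are functions 'x \<times> 'x \<times> 'x \<Rightarrow> complex.
  A d-class scheme on X = UNIV :: 'x set is given by an indexed family R 0, ..., R d
  of relations (this indexing is the ordering of the adjacency matrices).\<close>

type_synonym 'x mat = "'x \<Rightarrow> 'x \<Rightarrow> complex"

definition sym_assoc_scheme :: "nat \<Rightarrow> (nat \<Rightarrow> ('x::finite \<times> 'x) set) \<Rightarrow> bool" where
  "sym_assoc_scheme d R \<longleftrightarrow>
     (\<forall>i\<le>d. R i \<noteq> {}) \<and>
     (\<forall>x y. \<exists>!i. i \<le> d \<and> (x, y) \<in> R i) \<and>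
     R 0 = {(x, y). x = y} \<and>
     (\<forall>i\<le>d. \<forall>x y. (x, y) \<in> R i \<longrightarrow> (y, x) \<in> R i) \<and>
     (\<forall>i\<le>d. \<forall>j\<le>d. \<forall>k\<le>d. \<forall>x y x' y'. (x, y) \<in> R k \<longrightarrow> (x', y') \<in> R k \<longrightarrow>
        card {z. (x, z) \<in> R i \<and> (z, y) \<in> R j} = card {z. (x', z) \<in> R i \<and> (z, y') \<in> R j})"

definition adj_mat :: "(nat \<Rightarrow> ('x \<times> 'x) set) \<Rightarrow> nat \<Rightarrow> 'x mat" where
  "adj_mat R i = (\<lambda>x y. if (x, y) \<in> R i then 1 else 0)"

definition bose_mesner :: "nat \<Rightarrow> (nat \<Rightarrow> ('x \<times> 'x) set) \<Rightarrow> 'x mat set" where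
  "bose_mesner d R = {M. \<exists>c::nat \<Rightarrow> complex. M = (\<lambda>x y. \<Sum>i\<le>d. c i * adj_mat R i x y)}"

definition mmult :: "('x::finite) mat \<Rightarrow> 'x mat \<Rightarrow> 'x mat" where
  "mmult L M = (\<lambda>x z. \<Sum>y\<in>UNIV. L x y * M y z)"

definition schur :: "'x mat \<Rightarrow> 'x mat \<Rightarrow> 'x mat" where
  "schur L M = (\<lambda>x y. L x y * M x y)"

definition id_mat :: "'x mat" where
  "id_mat = (\<lambda>x y. if x = y then 1 else 0)"

definition zero_mat :: "'x mat" where
  "zero_mat = (\<lambda>x y. 0)"

text \<open>E 0, ..., E d is an ordering of the primitive idempotents: a basis of the
  Bose-Mesner algebra of symmetric, pairwise orthogonal idempotents summing to I.\<close>
definition prim_idempotents :: "nat \<Rightarrow> (nat \<Rightarrow> ('x::finite \<times> 'x) set) \<Rightarrow> (nat \<Rightarrow> 'x mat) \<Rightarrow> bool" where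
  "prim_idempotents d R E \<longleftrightarrow>
     (\<forall>i\<le>d. E i \<in> bose_mesner d R) \<and>
     (\<forall>i\<le>d. \<forall>x y. E i x y = E i y x) \<and>
     (\<forall>i\<le>d. \<forall>j\<le>d. mmult (E i) (E j) = (if i = j then E i else zero_mat)) \<and>
     (\<lambda>x y. \<Sum>i\<le>d. E i x y) = id_mat \<and>
     (\<forall>c::nat \<Rightarrow> complex. (\<lambda>x y. \<Sum>i\<le>d. c i * E i x y) = zero_mat \<longrightarrow> (\<forall>i\<le>d. c i = 0))"

text \<open>Krein parameter q_{rs}^t: E_r \<circ> E_s = |X|^{-1} \<Sum>_k q_{rs}^k E_k.\<close>
definition krein :: "nat \<Rightarrow> (nat \<Rightarrow> ('x::finite) mat) \<Rightarrow> nat \<Rightarrow> nat \<Rightarrow> nat \<Rightarrow> complex" where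
  "krein d E r s t = (THE q::nat \<Rightarrow> complex. (\<forall>k>d. q k = 0) \<and>
      schur (E r) (E s) = (\<lambda>x y. (1 / of_nat CARD('x)) * (\<Sum>k\<le>d. q k * E k x y))) t"

definition cpos :: "complex \<Rightarrow> bool" where
  "cpos q \<longleftrightarrow> Im q = 0 \<and> Re q > 0"

definition Delta :: "'x mat \<Rightarrow> 'x mat \<Rightarrow> 'x mat \<Rightarrow> ('x \<times> 'x \<times> 'x \<Rightarrow> complex)" where
  "Delta L M N = (\<lambda>(x, y, z). L x z * M x y * N y z)"

definition Upsilon :: "('x::finite) mat \<Rightarrow> 'x mat \<Rightarrow> 'x mat \<Rightarrow> ('x \<times> 'x \<times> 'x \<Rightarrow> complex)" where
  "Upsilon L M N = (\<lambda>(x, y, z). \<Sum>u\<in>UNIV. L x u * M y u * N z u)"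

definition cspan :: "('a \<Rightarrow> complex) set \<Rightarrow> ('a \<Rightarrow> complex) set" where
  "cspan S = {f. \<exists>T c. finite T \<and> T \<subseteq> S \<and> f = (\<lambda>a. \<Sum>g\<in>T. c g * g a)}"

definition Delta_alg :: "nat \<Rightarrow> (nat \<Rightarrow> ('x \<times> 'x) set) \<Rightarrow> ('x \<times> 'x \<times> 'x \<Rightarrow> complex) set" where
  "Delta_alg d R = cspan {Delta L M N | L M N.
      L \<in> bose_mesner d R \<and> M \<in> bose_mesner d R \<and> N \<in> bose_mesner d R}"

definition Upsilon_alg :: "nat \<Rightarrow> (nat \<Rightarrow> ('x::finite \<times> 'x) set) \<Rightarrow> ('x \<times> 'x \<times> 'x \<Rightarrow> complex) set" where
  "Upsilon_alg d R = cspan {Upsilon L M N | L M N.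
      L \<in> bose_mesner d R \<and> M \<in> bose_mesner d R \<and> N \<in> bose_mesner d R}"

definition exactly_triply_regular :: "nat \<Rightarrow> (nat \<Rightarrow> ('x::finite \<times> 'x) set) \<Rightarrow> bool" where
  "exactly_triply_regular d R \<longleftrightarrow>
     Upsilon_alg d R \<subseteq> Delta_alg d R \<and> Delta_alg d R \<subseteq> Upsilon_alg d R"

text \<open>Delta-Wye parameters sigma^{i,j,k}_{r,s,t} (as a function of r s t), zero when
  q_{rs}^t is not positive (or an index exceeds d).\<close>
definition dw_sigma :: "nat \<Rightarrow> (nat \<Rightarrow> ('x::finite \<times> 'x) set) \<Rightarrow> (nat \<Rightarrow> 'x mat)
    \<Rightarrow> nat \<Rightarrow> nat \<Rightarrow> nat \<Rightarrow> (nat \<Rightarrow> nat \<Rightarrow> nat \<Rightarrow> complex)" where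
  "dw_sigma d R E i j k = (THE \<sigma>.
     (\<forall>r s t. \<not> (r \<le> d \<and> s \<le> d \<and> t \<le> d \<and> cpos (krein d E r s t)) \<longrightarrow> \<sigma> r s t = 0) \<and>
     Delta (adj_mat R i) (adj_mat R j) (adj_mat R k) =
       (\<lambda>a. \<Sum>(r, s, t)\<in>{(r, s, t). r \<le> d \<and> s \<le> d \<and> t \<le> d \<and> cpos (krein d E r s t)}.
              \<sigma> r s t * Upsilon (E r) (E s) (E t) a))"

text \<open>Finite graphs with loops and multiple edges: vertex set V, edge set Ed,
  ends e = (a_e, b_e).\<close>
definition finite_graph :: "'v set \<Rightarrow> 'e set \<Rightarrow> ('e \<Rightarrow> 'v \<times> 'v) \<Rightarrow> bool" where
  "finite_graph V Ed ends \<longleftrightarrow> finite V \<and> finite Ed \<and> (\<forall>e\<in>Ed. fst (ends e) \<in> V \<and> snd (ends e) \<in> V)"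

definition graph_connected :: "'v set \<Rightarrow> 'e set \<Rightarrow> ('e \<Rightarrow> 'v \<times> 'v) \<Rightarrow> bool" where
  "graph_connected V Ed ends \<longleftrightarrow> V \<noteq> {} \<and>
     (\<forall>u\<in>V. \<forall>v\<in>V. (u, v) \<in> {(a, b). \<exists>e\<in>Ed. ends e = (a, b) \<or> ends e = (b, a)}\<^sup>*)"

text \<open>A planar embedding: vertices to distinct points of the plane, non-loop edges to
  arcs joining the images of their ends, loops to simple closed curves through the
  image of their vertex; an edge meets the vertex points only at its ends, and two
  distinct edges meet only in vertex points.\<close>
definition planar_embedding :: "'v set \<Rightarrow> 'e set \<Rightarrow> ('e \<Rightarrow> 'v \<times> 'v)
    \<Rightarrow> ('v \<Rightarrow> real^2) \<Rightarrow> ('e \<Rightarrow> real \<Rightarrow> real^2) \<Rightarrow> bool" where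
  "planar_embedding V Ed ends p c \<longleftrightarrow>
     inj_on p V \<and>
     (\<forall>e\<in>Ed. case ends e of (a, b) \<Rightarrow>
        pathstart (c e) = p a \<and> pathfinish (c e) = p b \<and>
        (if a = b then simple_path (c e) else arc (c e)) \<and>
        path_image (c e) \<inter> p ` V \<subseteq> {p a, p b}) \<and>
     (\<forall>e\<in>Ed. \<forall>e'\<in>Ed. e \<noteq> e' \<longrightarrow> path_image (c e) \<inter> path_image (c e') \<subseteq> p ` V)"

definition planar_graph :: "'v set \<Rightarrow> 'e set \<Rightarrow> ('e \<Rightarrow> 'v \<times> 'v) \<Rightarrow> bool" where
  "planar_graph V Ed ends \<longleftrightarrow> (\<exists>p c. planar_embedding V Ed ends p c)"

text \<open>Scaffold of order zero S(F, \<emptyset>; w).\<close>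
definition scaffold0 :: "'v set \<Rightarrow> 'e set \<Rightarrow> ('e \<Rightarrow> 'v \<times> 'v) \<Rightarrow> ('e \<Rightarrow> ('x::finite) mat) \<Rightarrow> complex" where
  "scaffold0 V Ed ends w =
     (\<Sum>\<phi>\<in>PiE V (\<lambda>_. UNIV). \<Prod>e\<in>Ed. w e (\<phi> (fst (ends e))) (\<phi> (snd (ends e))))"

end

theory Submission
  imports Defs "HOL-Library.Function_Algebras"
begin

text \<open>Call a graph good if its scaffold value is the same for \<open>w\<close> and \<open>\<kappa> \<circ> w\<close>, for all weights.
  Since \<open>I\<close> and \<open>J\<close> belong to the Bose-Mesner algebra, contracted edges can be given weight \<open>I\<close> and
  deleted edges weight \<open>J\<close>, so minors of good graphs are good. A planar graph without loops is a
  minor of a fine square grid: replace each vertex by a small square around its image and each arc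
  by the grid points close to it. Hence it suffices to treat square grids. There, removing a corner
  vertex in series creates a diagonal edge in the adjacent cell; a triangle-star exchange followed by
  a star-triangle exchange moves this edge to the next cell on the diagonal, until it is absorbed
  at the boundary. So the grid can be taken apart vertex by vertex.

  Both exchanges have the same coefficients in the two schemes. For triangle to star these are
  the Delta-Wye parameters. They also determine which stars of primitive idempotents vanish and all
  eigenvalues \<open>P\<^sub>r\<^sub>i\<close>, so \<open>\<kappa>\<close> maps \<open>E\<^sub>r\<close> to \<open>E'\<^sub>r\<close>, is multiplicative, and preserves the coefficients of
  star to triangle.\<close>

section \<open>Spans of complex functions\<close>

interpretation cfun: vector_space "\<lambda>(c::complex) (f::'a \<Rightarrow> complex) a. c * f a"
  by unfold_locales (auto simp: fun_eq_iff algebra_simps)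

lemma sum_fun_apply: "(\<Sum>i\<in>I. f i) a = (\<Sum>i\<in>I. f i a :: 'b::comm_monoid_add)"
  by (induction I rule: infinite_finite_induct) auto

lemma cspan_eq_span: "cspan S = cfun.span S"
  unfolding cspan_def cfun.span_explicit by (auto simp: fun_eq_iff sum_fun_apply)

lemma cspan_base: "f \<in> S \<Longrightarrow> f \<in> cspan S"
  by (simp add: cspan_eq_span cfun.span_base)

lemma cspan_minimal: "S \<subseteq> cspan T \<Longrightarrow> cspan S \<subseteq> cspan T"
  unfolding cspan_eq_span by (rule cfun.span_minimal[OF _ cfun.subspace_span])

lemma cspan_sum:
  assumes "\<And>i. i \<in> I \<Longrightarrow> f i \<in> cspan S"
  shows "(\<lambda>a. \<Sum>i\<in>I. c i * f i a) \<in> cspan S"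
proof -
  have "(\<Sum>i\<in>I. (\<lambda>a. c i * f i a)) \<in> cfun.span S"
    using assms by (intro cfun.span_sum cfun.span_scale) (simp add: cspan_eq_span)
  moreover have "(\<Sum>i\<in>I. (\<lambda>a. c i * f i a)) = (\<lambda>a. \<Sum>i\<in>I. c i * f i a)"
    by (simp add: fun_eq_iff sum_fun_apply)
  ultimately show ?thesis by (simp add: cspan_eq_span)
qed

lemma cspan_image:
  assumes "finite I"
  shows "cspan (f ` I) = {\<lambda>a. \<Sum>i\<in>I. c i * f i a | c. True}"
proof (intro equalityI subsetI)
  fix h assume "h \<in> cspan (f ` I)"
  then obtain T c where T: "T \<subseteq> f ` I" and h: "h = (\<lambda>a. \<Sum>g\<in>T. c g * g a)"
    by (auto simp: cspan_def)
  from T obtain J where J: "J \<subseteq> I" "inj_on f J" "T = f ` J" by (auto simp: subset_image_inj)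
  have "(\<Sum>g\<in>T. c g * g a) = (\<Sum>i\<in>I. (if i \<in> J then c (f i) else 0) * f i a)" for a
  proof -
    have "(\<Sum>g\<in>T. c g * g a) = (\<Sum>i\<in>J. c (f i) * f i a)"
      using J by (simp add: sum.reindex)
    also have "\<dots> = (\<Sum>i\<in>I. (if i \<in> J then c (f i) else 0) * f i a)"
      using assms J(1) by (intro sum.mono_neutral_cong_left) auto
    finally show ?thesis .
  qed
  then have "h = (\<lambda>a. \<Sum>i\<in>I. (if i \<in> J then c (f i) else 0) * f i a)"
    unfolding h by (rule ext)
  then show "h \<in> {\<lambda>a. \<Sum>i\<in>I. c i * f i a | c. True}"
    by (intro CollectI exI conjI TrueI)
next
  fix h assume "h \<in> {\<lambda>a. \<Sum>i\<in>I. c i * f i a | c. True}"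
  then obtain c where h: "h = (\<lambda>a. \<Sum>i\<in>I. c i * f i a)" by blast
  show "h \<in> cspan (f ` I)" unfolding h by (intro cspan_sum cspan_base imageI)
qed

lemma cspan_independent_family:
  assumes fin: "finite I" and sub: "f ` I \<subseteq> cspan (g ` I)"
    and indep: "\<And>c i. (\<lambda>a. \<Sum>i\<in>I. c i * f i a) = (\<lambda>_. 0) \<Longrightarrow> i \<in> I \<Longrightarrow> c i = 0"
  shows "cspan (f ` I) = cspan (g ` I)"
proof (rule ccontr)
  assume "cspan (f ` I) \<noteq> cspan (g ` I)"
  then obtain h where h: "h \<in> cspan (g ` I)" "h \<notin> cspan (f ` I)" using cspan_minimal[OF sub] by blast
  have inj: "inj_on f I"
  proof (rule inj_onI, rule ccontr)
    fix i j assume ij: "i \<in> I" "j \<in> I" "f i = f j" "i \<noteq> j"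
    have "(\<lambda>a. \<Sum>k\<in>I. (if k = i then 1 else if k = j then - 1 else 0) * f k a) = (\<lambda>_. 0)"
    proof
      fix a
      have "(\<Sum>k\<in>I. (if k = i then 1 else if k = j then - 1 else 0) * f k a) =
          (\<Sum>k\<in>{i, j}. (if k = i then 1 else if k = j then - 1 else 0) * f k a)"
        using fin ij by (intro sum.mono_neutral_right) auto
      then show "(\<Sum>k\<in>I. (if k = i then 1 else if k = j then - 1 else 0) * f k a) = 0"
        using ij by simp
    qed
    from indep[OF this ij(1)] show False by simp
  qed
  have "cfun.independent (f ` I)"
    unfolding cfun.dependent_finite[OF finite_imageI[OF fin]]
  proof (clarsimp simp: sum.reindex[OF inj])
    fix u i assume "i \<in> I" "u (f i) \<noteq> 0" and "(\<Sum>k\<in>I. (\<lambda>a. u (f k) * f k a)) = 0"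
    then show False using indep[of "\<lambda>k. u (f k)" i] by (auto simp: fun_eq_iff sum_fun_apply)
  qed
  then have "cfun.independent (insert h (f ` I))"
    using h(2) by (intro cfun.independent_insertI) (simp_all add: cspan_eq_span)
  then have "card (insert h (f ` I)) \<le> card (g ` I)"
    using cfun.independent_span_bound[of "g ` I"] fin sub h(1) by (simp add: cspan_eq_span)
  moreover have "h \<notin> f ` I" using h(2) cspan_base by blast
  ultimately show False
    using fin card_image_le[OF fin, of g] by (simp add: card_image[OF inj])
qed

section \<open>Scaffolds with an additional factor\<close>

definition edge_product :: "('v \<times> 'v) set \<Rightarrow> ('v \<times> 'v \<Rightarrow> 'x mat) \<Rightarrow> ('v \<Rightarrow> 'x) \<Rightarrow> complex" where
  "edge_product P w \<phi> = (\<Prod>e\<in>P. w e (\<phi> (fst e)) (\<phi> (snd e)))"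

definition weighted_scaffold ::
    "'v set \<Rightarrow> ('v \<times> 'v) set \<Rightarrow> ('v \<times> 'v \<Rightarrow> ('x::finite) mat) \<Rightarrow> (('v \<Rightarrow> 'x) \<Rightarrow> complex) \<Rightarrow> complex" where
  "weighted_scaffold V P w h = (\<Sum>\<phi>\<in>PiE V (\<lambda>_. UNIV). edge_product P w \<phi> * h \<phi>)"

lemma scaffold0_eq_sum_edge_product:
  "scaffold0 V P id w = (\<Sum>\<phi>\<in>PiE V (\<lambda>_. UNIV). edge_product P w \<phi>)"
  by (simp add: scaffold0_def edge_product_def)

lemma scaffold0_eq_weighted_scaffold: "scaffold0 V P id w = weighted_scaffold V P w (\<lambda>_. 1)"
  by (simp add: scaffold0_eq_sum_edge_product weighted_scaffold_def)

lemma edge_product_cong: "(\<And>e. e \<in> P \<Longrightarrow> w e = w' e) \<Longrightarrow> edge_product P w \<phi> = edge_product P w' \<phi>"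
  by (simp add: edge_product_def)

lemma edge_product_fun_upd: "v \<notin> Field P \<Longrightarrow> edge_product P w (\<phi>(v := x)) = edge_product P w \<phi>"
  unfolding edge_product_def by (intro prod.cong) (auto simp: Field_def)

lemma weighted_scaffold_insert:
  assumes "finite P" "e \<notin> P"
  shows "weighted_scaffold V (insert e P) w h =
    weighted_scaffold V P w (\<lambda>\<phi>. w e (\<phi> (fst e)) (\<phi> (snd e)) * h \<phi>)"
  using assms by (simp add: weighted_scaffold_def edge_product_def mult_ac)

lemma weighted_scaffold_eliminate:
  fixes h :: "('v \<Rightarrow> 'x::finite) \<Rightarrow> complex"
  assumes "v \<in> V" "v \<notin> Field P"
  shows "weighted_scaffold V P w h = weighted_scaffold (V - {v}) P w (\<lambda>\<psi>. \<Sum>x\<in>UNIV. h (\<psi>(v := x)))"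
proof -
  let ?B = "PiE (V - {v}) (\<lambda>_. UNIV :: 'x set)"
  have "PiE V (\<lambda>_. UNIV) = (\<lambda>(x, \<psi>). \<psi>(v := x)) ` (UNIV \<times> ?B)"
    using PiE_insert_eq[of v "V - {v}" "\<lambda>_. UNIV"] \<open>v \<in> V\<close> by (simp add: insert_absorb)
  moreover have "inj_on (\<lambda>(x, \<psi>). \<psi>(v := x)) (UNIV \<times> ?B)"
    by (rule inj_combinator) simp
  ultimately have "weighted_scaffold V P w h =
      (\<Sum>(x, \<psi>)\<in>UNIV \<times> ?B. edge_product P w \<psi> * h (\<psi>(v := x)))"
    using \<open>v \<notin> Field P\<close>
    by (simp add: weighted_scaffold_def sum.reindex case_prod_unfold edge_product_fun_upd)
  also have "\<dots> = (\<Sum>\<psi>\<in>?B. \<Sum>x\<in>UNIV. edge_product P w \<psi> * h (\<psi>(v := x)))"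
    unfolding sum.cartesian_product[symmetric] by (rule sum.swap)
  finally show ?thesis by (simp add: weighted_scaffold_def sum_distrib_left)
qed

lemma weighted_scaffold_sum:
  "weighted_scaffold V P w (\<lambda>\<phi>. \<Sum>k\<in>K. c k * h k \<phi>) = (\<Sum>k\<in>K. c k * weighted_scaffold V P w (h k))"
  by (simp add: weighted_scaffold_def sum_distrib_left sum.swap[of _ K] mult.left_commute)

section \<open>Star-triangle moves\<close>

lemma sum_Upsilon_leg_star:
  assumes "\<And>x y. H x y = H y x" "\<And>x y. M x y = M y x" "\<And>x y. N x y = N y x"
  shows "(\<Sum>x\<in>UNIV. Upsilon F G H (y, z, x) * (M x s * N x t)) =
    (\<Sum>u\<in>UNIV. Upsilon H M N (u, s, t) * (F y u * G z u))"
proof -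
  have "(\<Sum>x\<in>UNIV. Upsilon F G H (y, z, x) * (M x s * N x t)) =
      (\<Sum>x\<in>UNIV. \<Sum>u\<in>UNIV. H u x * M s x * N t x * (F y u * G z u))"
    using assms by (simp add: Upsilon_def sum_distrib_left sum_distrib_right mult_ac)
  also have "\<dots> = (\<Sum>u\<in>UNIV. \<Sum>x\<in>UNIV. H u x * M s x * N t x * (F y u * G z u))"
    by (rule sum.swap)
  finally show ?thesis by (simp add: Upsilon_def sum_distrib_right)
qed

lemma sum_Upsilon_leg_edge:
  assumes "\<And>x y. H x y = H y x"
  shows "(\<Sum>x\<in>UNIV. Upsilon F G H (y, z, x) * M x s) = (\<Sum>u\<in>UNIV. F y u * G z u * mmult H M u s)"
proof -
  have "(\<Sum>x\<in>UNIV. Upsilon F G H (y, z, x) * M x s) =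
      (\<Sum>x\<in>UNIV. \<Sum>u\<in>UNIV. F y u * G z u * (H u x * M x s))"
    using assms by (simp add: Upsilon_def sum_distrib_left sum_distrib_right mult_ac)
  also have "\<dots> = (\<Sum>u\<in>UNIV. \<Sum>x\<in>UNIV. F y u * G z u * (H u x * M x s))"
    by (rule sum.swap)
  finally show ?thesis by (simp add: mmult_def sum_distrib_left)
qed

text \<open>A pair of tensors is encoded as one function on a disjoint union, so that linear combinations of
  pairs use the same coefficients in both components.\<close>

definition star_pairs ::
    "(('x::finite) mat \<times> ('y::finite) mat) set \<Rightarrow> (('x \<times> 'x \<times> 'x) + ('y \<times> 'y \<times> 'y) \<Rightarrow> complex) set" where
  "star_pairs \<A> = {case_sum (Upsilon F G H) (Upsilon F' G' H') | F F' G G' H H'.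
    (F, F') \<in> \<A> \<and> (G, G') \<in> \<A> \<and> (H, H') \<in> \<A>}"

definition triangle_pairs ::
    "('x mat \<times> 'y mat) set \<Rightarrow> (('x \<times> 'x \<times> 'x) + ('y \<times> 'y \<times> 'y) \<Rightarrow> complex) set" where
  "triangle_pairs \<A> = {case_sum (Delta F G H) (Delta F' G' H') | F F' G G' H H'.
    (F, F') \<in> \<A> \<and> (G, G') \<in> \<A> \<and> (H, H') \<in> \<A>}"

lemma star_pairsI:
  "\<lbrakk>(F, F') \<in> \<A>; (G, G') \<in> \<A>; (H, H') \<in> \<A>\<rbrakk> \<Longrightarrow>
    case_sum (Upsilon F G H) (Upsilon F' G' H') \<in> star_pairs \<A>"
  unfolding star_pairs_def by blast

lemma triangle_pairsI:
  "\<lbrakk>(F, F') \<in> \<A>; (G, G') \<in> \<A>; (H, H') \<in> \<A>\<rbrakk> \<Longrightarrow>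
    case_sum (Delta F G H) (Delta F' G' H') \<in> triangle_pairs \<A>"
  unfolding triangle_pairs_def by blast

locale star_triangle_pair =
  fixes \<A> :: "(('x::finite) mat \<times> ('y::finite) mat) set"
  assumes symmetric_left: "(M, M') \<in> \<A> \<Longrightarrow> M x y = M y x"
    and symmetric_right: "(M, M') \<in> \<A> \<Longrightarrow> M' x' y' = M' y' x'"
    and ones_mem: "(\<lambda>_ _. 1, \<lambda>_ _. 1) \<in> \<A>"
    and id_mem: "(id_mat, id_mat) \<in> \<A>"
    and mmult_mem: "\<lbrakk>(L, L') \<in> \<A>; (M, M') \<in> \<A>\<rbrakk> \<Longrightarrow> (mmult L M, mmult L' M') \<in> \<A>"
    and column_sum: "(M, M') \<in> \<A> \<Longrightarrow>
      \<exists>m. (\<forall>y. (\<Sum>x\<in>UNIV. M x y) = m) \<and> (\<forall>y. (\<Sum>x\<in>UNIV. M' x y) = m)"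
    and diagonal: "(M, M') \<in> \<A> \<Longrightarrow> \<exists>m. (\<forall>x. M x x = m) \<and> (\<forall>x. M' x x = m)"
    and delta_wye: "triangle_pairs \<A> \<subseteq> cspan (star_pairs \<A>)"
    and wye_delta: "star_pairs \<A> \<subseteq> cspan (triangle_pairs \<A>)"
begin

lemma card_eq: "CARD('x) = CARD('y)"
  using column_sum[OF ones_mem] by auto

definition agree :: "'v set \<Rightarrow> ('v \<times> 'v) set \<Rightarrow> (('v \<Rightarrow> 'x) \<Rightarrow> complex) \<Rightarrow> (('v \<Rightarrow> 'y) \<Rightarrow> complex) \<Rightarrow> bool" where
  "agree V P h h' \<longleftrightarrow> (\<forall>w w'. (\<forall>e\<in>P. (w e, w' e) \<in> \<A>) \<longrightarrow>
     weighted_scaffold V P w h = weighted_scaffold V P w' h')"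

definition transfers :: "'v set \<Rightarrow> ('v \<times> 'v) set \<Rightarrow> bool" where
  "transfers V P \<longleftrightarrow> agree V P (\<lambda>_. 1) (\<lambda>_. 1)"

lemma transfersD:
  "transfers V P \<Longrightarrow> (\<And>e. e \<in> P \<Longrightarrow> (w e, w' e) \<in> \<A>) \<Longrightarrow> scaffold0 V P id w = scaffold0 V P id w'"
  by (simp add: transfers_def agree_def scaffold0_eq_weighted_scaffold)

lemma agree_insert_iff:
  fixes V :: "'v set"
  assumes "finite P" "e \<notin> P"
  shows "agree V (insert e P) h h' \<longleftrightarrow> (\<forall>M M'. (M, M') \<in> \<A> \<longrightarrow>
    agree V P (\<lambda>\<phi>. M (\<phi> (fst e)) (\<phi> (snd e)) * h \<phi>) (\<lambda>\<phi>. M' (\<phi> (fst e)) (\<phi> (snd e)) * h' \<phi>))"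
    (is "_ \<longleftrightarrow> ?agree_factor")
proof
  assume agree: "agree V (insert e P) h h'"
  show ?agree_factor
    unfolding agree_def
  proof (intro allI impI)
    fix M M' w w' assume M: "(M, M') \<in> \<A>" and w: "\<forall>e\<in>P. (w e, w' e) \<in> \<A>"
    have upd: "weighted_scaffold V (insert e P) (v(e := L)) f =
        weighted_scaffold V P v (\<lambda>\<phi>. L (\<phi> (fst e)) (\<phi> (snd e)) * f \<phi>)"
      for v :: "'v \<times> 'v \<Rightarrow> 'z::finite mat" and L and f :: "('v \<Rightarrow> 'z) \<Rightarrow> complex"
    proof -
      have "edge_product P (v(e := L)) \<phi> = edge_product P v \<phi>" for \<phi>
        using assms by (intro edge_product_cong) auto
      then show ?thesis
        by (simp add: weighted_scaffold_insert[OF assms]) (simp add: weighted_scaffold_def)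
    qed
    have "weighted_scaffold V (insert e P) (w(e := M)) h =
        weighted_scaffold V (insert e P) (w'(e := M')) h'"
      using agree M w unfolding agree_def by auto
    then show "weighted_scaffold V P w (\<lambda>\<phi>. M (\<phi> (fst e)) (\<phi> (snd e)) * h \<phi>) =
        weighted_scaffold V P w' (\<lambda>\<phi>. M' (\<phi> (fst e)) (\<phi> (snd e)) * h' \<phi>)"
      unfolding upd .
  qed
next
  assume ?agree_factor
  then show "agree V (insert e P) h h'"
    using assms by (simp add: agree_def weighted_scaffold_insert)
qed

lemma agree_eliminate_iff:
  assumes "v \<in> V" "v \<notin> Field P"
  shows "agree V P h h' \<longleftrightarrow>
    agree (V - {v}) P (\<lambda>\<psi>. \<Sum>x\<in>UNIV. h (\<psi>(v := x))) (\<lambda>\<psi>. \<Sum>x\<in>UNIV. h' (\<psi>(v := x)))"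
  by (simp add: agree_def weighted_scaffold_eliminate[OF assms])

lemma agree_scale: "agree V P h h' \<Longrightarrow> agree V P (\<lambda>\<phi>. c * h \<phi>) (\<lambda>\<phi>. c * h' \<phi>)"
  by (simp add: agree_def weighted_scaffold_def mult.left_commute flip: sum_distrib_left)

lemma agree_cspan:
  assumes T: "case_sum T T' \<in> cspan S"
    and agree: "\<And>g. g \<in> S \<Longrightarrow> agree V P (\<lambda>\<phi>. \<Sum>x\<in>X. g (Inl (t \<phi> x)) * f \<phi> x)
      (\<lambda>\<phi>. \<Sum>y\<in>Y. g (Inr (t' \<phi> y)) * f' \<phi> y)"
  shows "agree V P (\<lambda>\<phi>. \<Sum>x\<in>X. T (t \<phi> x) * f \<phi> x) (\<lambda>\<phi>. \<Sum>y\<in>Y. T' (t' \<phi> y) * f' \<phi> y)"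
proof -
  obtain K c where K: "K \<subseteq> S" and T_eq: "case_sum T T' = (\<lambda>a. \<Sum>g\<in>K. c g * g a)"
    using T by (auto simp: cspan_def)
  have "T a = (\<Sum>g\<in>K. c g * g (Inl a))" "T' b = (\<Sum>g\<in>K. c g * g (Inr b))" for a b
    using fun_cong[OF T_eq, of "Inl a"] fun_cong[OF T_eq, of "Inr b"] by simp_all
  then have "(\<Sum>x\<in>X. T (t \<phi> x) * f \<phi> x) = (\<Sum>g\<in>K. c g * (\<Sum>x\<in>X. g (Inl (t \<phi> x)) * f \<phi> x))"
    "(\<Sum>y\<in>Y. T' (t' \<phi>' y) * f' \<phi>' y) = (\<Sum>g\<in>K. c g * (\<Sum>y\<in>Y. g (Inr (t' \<phi>' y)) * f' \<phi>' y))" for \<phi> \<phi>'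
    by (simp_all add: sum_distrib_left sum_distrib_right mult.assoc sum.swap[of _ K])
  then show ?thesis
    using agree K by (auto simp: agree_def weighted_scaffold_sum intro!: sum.cong)
qed

lemma transfers_isolated:
  assumes "v \<in> V" "v \<notin> Field P" "transfers (V - {v}) P"
  shows "transfers V P"
  using agree_scale[OF assms(3)[unfolded transfers_def], of "of_nat CARD('x)"] assms(1,2)
  by (simp add: transfers_def agree_eliminate_iff[of v] card_eq)

lemma transfers_pendant:
  assumes "v \<in> V" "finite P" "v \<notin> Field P" "a \<noteq> v" and base: "transfers (V - {v}) P"
  shows "transfers V (insert (v, a) P)"
proof -
  have "agree V P (\<lambda>\<phi>. M (\<phi> v) (\<phi> a)) (\<lambda>\<phi>. M' (\<phi> v) (\<phi> a))" if "(M, M') \<in> \<A>" for M M'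
  proof -
    obtain m where "\<And>y. (\<Sum>x\<in>UNIV. M x y) = m" "\<And>y. (\<Sum>x\<in>UNIV. M' x y) = m"
      using column_sum[OF \<open>(M, M') \<in> \<A>\<close>] by blast
    then show ?thesis
      using assms agree_scale[OF base[unfolded transfers_def], of m]
      by (simp add: agree_eliminate_iff[of v])
  qed
  moreover have "(v, a) \<notin> P" using \<open>v \<notin> Field P\<close> by (auto simp: Field_def)
  ultimately show ?thesis using \<open>finite P\<close> by (simp add: transfers_def agree_insert_iff)
qed

lemma transfers_series:
  assumes P: "v \<in> V" "finite P" "v \<notin> Field P" and ab: "a \<noteq> v" "b \<noteq> v" "a \<noteq> b" "(a, b) \<notin> P"
    and base: "transfers (V - {v}) (insert (a, b) P)"
  shows "transfers V (insert (v, a) (insert (v, b) P))"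
proof -
  have "agree (V - {v}) P (\<lambda>\<psi>. \<Sum>x\<in>UNIV. M x (\<psi> b) * L x (\<psi> a)) (\<lambda>\<psi>. \<Sum>x\<in>UNIV. M' x (\<psi> b) * L' x (\<psi> a))"
    if L: "(L, L') \<in> \<A>" and M: "(M, M') \<in> \<A>" for L L' M M'
  proof -
    have "agree (V - {v}) P (\<lambda>\<psi>. mmult L M (\<psi> a) (\<psi> b)) (\<lambda>\<psi>. mmult L' M' (\<psi> a) (\<psi> b))"
      using base mmult_mem[OF L M] P ab by (simp add: transfers_def agree_insert_iff)
    then show ?thesis
      by (simp add: mmult_def mult.commute symmetric_left[OF L] symmetric_right[OF L])
  qed
  moreover have "(v, a) \<notin> insert (v, b) P" "(v, b) \<notin> P"
    using P ab by (auto simp: Field_def)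
  ultimately show ?thesis
    using P ab by (simp add: transfers_def agree_insert_iff agree_eliminate_iff[of v])
qed

text \<open>Replacing the triangle \<open>a, b, v\<close> by a star with centre \<open>u\<close> leaves \<open>v\<close> with the three
  neighbours \<open>u\<close>, \<open>c\<close> and \<open>e\<close>; replacing this star by a triangle restores the original graph,
  with \<open>u\<close> in the place of \<open>v\<close>, except that the edge \<open>ab\<close> has moved to the opposite side.\<close>

lemma agree_triangle_star_triangle:
  assumes shifted: "\<And>F F' G G' K K' L L' D D'.
      \<lbrakk>(F, F') \<in> \<A>; (G, G') \<in> \<A>; (K, K') \<in> \<A>; (L, L') \<in> \<A>; (D, D') \<in> \<A>\<rbrakk> \<Longrightarrow>
      agree V P (\<lambda>\<psi>. \<Sum>u\<in>UNIV. Delta K L D (u, \<psi> c, \<psi> e) * (F (\<psi> a) u * G (\<psi> b) u))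
        (\<lambda>\<psi>. \<Sum>u\<in>UNIV. Delta K' L' D' (u, \<psi> c, \<psi> e) * (F' (\<psi> a) u * G' (\<psi> b) u))"
    and A: "(A, A') \<in> \<A>" and D: "(D, D') \<in> \<A>" and B: "(B, B') \<in> \<A>"
    and M: "(M, M') \<in> \<A>" and N: "(N, N') \<in> \<A>"
  shows "agree V P (\<lambda>\<psi>. \<Sum>x\<in>UNIV. Delta A D B (\<psi> a, \<psi> b, x) * (M x (\<psi> c) * N x (\<psi> e)))
    (\<lambda>\<psi>. \<Sum>x\<in>UNIV. Delta A' D' B' (\<psi> a, \<psi> b, x) * (M' x (\<psi> c) * N' x (\<psi> e)))"
proof (rule agree_cspan[OF subsetD[OF delta_wye triangle_pairsI[OF A D B]]],
    clarsimp simp: star_pairs_def)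
  fix F F' G G' H H' assume FG: "(F, F') \<in> \<A>" "(G, G') \<in> \<A>" and H: "(H, H') \<in> \<A>"
  have "agree V P (\<lambda>\<psi>. \<Sum>u\<in>UNIV. Upsilon H M N (u, \<psi> c, \<psi> e) * (F (\<psi> a) u * G (\<psi> b) u))
      (\<lambda>\<psi>. \<Sum>u\<in>UNIV. Upsilon H' M' N' (u, \<psi> c, \<psi> e) * (F' (\<psi> a) u * G' (\<psi> b) u))"
    by (rule agree_cspan[OF subsetD[OF wye_delta star_pairsI[OF H M N]]])
      (use shifted FG in \<open>auto simp: triangle_pairs_def\<close>)
  moreover have "(\<Sum>x\<in>UNIV. Upsilon F G H (y, z, x) * (M x s * N x t)) =
      (\<Sum>u\<in>UNIV. Upsilon H M N (u, s, t) * (F y u * G z u))" for y z s t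
    using H M N symmetric_left by (intro sum_Upsilon_leg_star) blast+
  moreover have "(\<Sum>x\<in>UNIV. Upsilon F' G' H' (y, z, x) * (M' x s * N' x t)) =
      (\<Sum>u\<in>UNIV. Upsilon H' M' N' (u, s, t) * (F' y u * G' z u))" for y z s t
    using H M N symmetric_right by (intro sum_Upsilon_leg_star) blast+
  ultimately show "agree V P (\<lambda>\<psi>. \<Sum>x\<in>UNIV. Upsilon F G H (\<psi> a, \<psi> b, x) * (M x (\<psi> c) * N x (\<psi> e)))
      (\<lambda>\<psi>. \<Sum>x\<in>UNIV. Upsilon F' G' H' (\<psi> a, \<psi> b, x) * (M' x (\<psi> c) * N' x (\<psi> e)))"
    by simp
qed

lemma transfers_shift_diagonal:
  assumes P: "v \<in> V" "finite P" "v \<notin> Field P" and v: "a \<noteq> v" "b \<noteq> v" "c \<noteq> v" "e \<noteq> v"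
    and ab: "a \<noteq> b" "(a, b) \<notin> P" and ce: "c \<noteq> e" "(e, c) \<notin> P"
    and base: "transfers V (insert (e, c) (P \<union> {(a, v), (b, v), (v, c), (v, e)}))"
  shows "transfers V (insert (a, b) (P \<union> {(a, v), (b, v), (v, c), (v, e)}))"
proof -
  have fresh: "(a, v) \<notin> P" "(b, v) \<notin> P" "(v, c) \<notin> P" "(v, e) \<notin> P"
    using P by (auto simp: Field_def)
  have transfers_iff: "transfers V (insert (p, q) (P \<union> {(a, v), (b, v), (v, c), (v, e)})) \<longleftrightarrow>
      (\<forall>D D'. (D, D') \<in> \<A> \<longrightarrow> (\<forall>A A'. (A, A') \<in> \<A> \<longrightarrow> (\<forall>B B'. (B, B') \<in> \<A> \<longrightarrow>
        (\<forall>M M'. (M, M') \<in> \<A> \<longrightarrow> (\<forall>N N'. (N, N') \<in> \<A> \<longrightarrow> agree (V - {v}) P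
          (\<lambda>\<psi>. \<Sum>x\<in>UNIV. N x (\<psi> e) * (M x (\<psi> c) * (B (\<psi> b) x * (A (\<psi> a) x * D (\<psi> p) (\<psi> q)))))
          (\<lambda>\<psi>. \<Sum>x\<in>UNIV. N' x (\<psi> e) * (M' x (\<psi> c) * (B' (\<psi> b) x * (A' (\<psi> a) x * D' (\<psi> p) (\<psi> q))))))))))"
    if "(p, q) \<notin> P" "p \<noteq> v" "q \<noteq> v" for p q
    using that P v ab ce fresh by (simp add: transfers_def agree_insert_iff agree_eliminate_iff[of v])
  have shifted: "agree (V - {v}) P
      (\<lambda>\<psi>. \<Sum>u\<in>UNIV. Delta K L D (u, \<psi> c, \<psi> e) * (F (\<psi> a) u * G (\<psi> b) u))
      (\<lambda>\<psi>. \<Sum>u\<in>UNIV. Delta K' L' D' (u, \<psi> c, \<psi> e) * (F' (\<psi> a) u * G' (\<psi> b) u))"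
    if FGKL: "(F, F') \<in> \<A>" "(G, G') \<in> \<A>" "(K, K') \<in> \<A>" "(L, L') \<in> \<A>" and D: "(D, D') \<in> \<A>"
    for F F' G G' K K' L L' D D'
  proof -
    have "agree (V - {v}) P
        (\<lambda>\<psi>. \<Sum>x\<in>UNIV. K x (\<psi> e) * (L x (\<psi> c) * (G (\<psi> b) x * (F (\<psi> a) x * D (\<psi> e) (\<psi> c)))))
        (\<lambda>\<psi>. \<Sum>x\<in>UNIV. K' x (\<psi> e) * (L' x (\<psi> c) * (G' (\<psi> b) x * (F' (\<psi> a) x * D' (\<psi> e) (\<psi> c)))))"
      by (rule base[unfolded transfers_iff[OF ce(2) v(4,3)], rule_format, OF D FGKL(1,2,4,3)])
    then show ?thesis
      by (simp add: Delta_def mult_ac symmetric_left[OF D] symmetric_right[OF D])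
  qed
  show ?thesis
    unfolding transfers_iff[OF ab(2) v(1,2)]
  proof (intro allI impI)
    fix D D' A A' B B' M M' N N'
    assume "(D, D') \<in> \<A>" "(A, A') \<in> \<A>" "(B, B') \<in> \<A>" "(M, M') \<in> \<A>" "(N, N') \<in> \<A>"
    then have "agree (V - {v}) P (\<lambda>\<psi>. \<Sum>x\<in>UNIV. Delta A D B (\<psi> a, \<psi> b, x) * (M x (\<psi> c) * N x (\<psi> e)))
        (\<lambda>\<psi>. \<Sum>x\<in>UNIV. Delta A' D' B' (\<psi> a, \<psi> b, x) * (M' x (\<psi> c) * N' x (\<psi> e)))"
      by (intro agree_triangle_star_triangle shifted)
    then show "agree (V - {v}) P
          (\<lambda>\<psi>. \<Sum>x\<in>UNIV. N x (\<psi> e) * (M x (\<psi> c) * (B (\<psi> b) x * (A (\<psi> a) x * D (\<psi> a) (\<psi> b)))))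
          (\<lambda>\<psi>. \<Sum>x\<in>UNIV. N' x (\<psi> e) * (M' x (\<psi> c) * (B' (\<psi> b) x * (A' (\<psi> a) x * D' (\<psi> a) (\<psi> b)))))"
      by (simp add: Delta_def mult_ac)
  qed
qed

text \<open>If \<open>v\<close> has only the one further neighbour \<open>c\<close>, the edge \<open>uv\<close> of the star merges with \<open>vc\<close>
  in series.\<close>

lemma transfers_absorb_diagonal:
  assumes P: "v \<in> V" "finite P" "v \<notin> Field P" and v: "a \<noteq> v" "b \<noteq> v" "c \<noteq> v"
    and ab: "a \<noteq> b" "(a, b) \<notin> P"
    and base: "transfers V (P \<union> {(a, v), (b, v), (v, c)})"
  shows "transfers V (insert (a, b) (P \<union> {(a, v), (b, v), (v, c)}))"
proof -
  have fresh: "(a, v) \<notin> P" "(b, v) \<notin> P" "(v, c) \<notin> P"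
    using P by (auto simp: Field_def)
  have star: "agree (V - {v}) P (\<lambda>\<psi>. \<Sum>x\<in>UNIV. Upsilon F G H (\<psi> a, \<psi> b, x) * M x (\<psi> c))
      (\<lambda>\<psi>. \<Sum>x\<in>UNIV. Upsilon F' G' H' (\<psi> a, \<psi> b, x) * M' x (\<psi> c))"
    if FG: "(F, F') \<in> \<A>" "(G, G') \<in> \<A>" and H: "(H, H') \<in> \<A>" and M: "(M, M') \<in> \<A>" for F F' G G' H H' M M'
  proof -
    have "agree (V - {v}) P (\<lambda>\<psi>. \<Sum>x\<in>UNIV. mmult H M x (\<psi> c) * (G (\<psi> b) x * F (\<psi> a) x))
        (\<lambda>\<psi>. \<Sum>x\<in>UNIV. mmult H' M' x (\<psi> c) * (G' (\<psi> b) x * F' (\<psi> a) x))"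
      using base FG mmult_mem[OF H M] P v ab fresh
      by (simp add: transfers_def agree_insert_iff agree_eliminate_iff[of v])
    then show ?thesis
      unfolding sum_Upsilon_leg_edge[OF symmetric_left[OF H], where M = M]
        sum_Upsilon_leg_edge[OF symmetric_right[OF H], where M = M']
      by (simp add: mult_ac)
  qed
  have "agree (V - {v}) P (\<lambda>\<psi>. \<Sum>x\<in>UNIV. Delta A D B (\<psi> a, \<psi> b, x) * M x (\<psi> c))
      (\<lambda>\<psi>. \<Sum>x\<in>UNIV. Delta A' D' B' (\<psi> a, \<psi> b, x) * M' x (\<psi> c))"
    if "(A, A') \<in> \<A>" "(D, D') \<in> \<A>" "(B, B') \<in> \<A>" "(M, M') \<in> \<A>" for A A' D D' B B' M M'
    by (rule agree_cspan[OF subsetD[OF delta_wye triangle_pairsI[OF that(1-3)]]])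
      (use star that(4) in \<open>auto simp: star_pairs_def\<close>)
  then show ?thesis
    using P v ab fresh
    by (simp add: transfers_def agree_insert_iff agree_eliminate_iff[of v] Delta_def mult_ac)
qed

end

section \<open>Reduction of grids\<close>

definition grid_edges :: "(int \<times> int) set \<Rightarrow> ((int \<times> int) \<times> int \<times> int) set" where
  "grid_edges U = {(p, q). p \<in> U \<and> q \<in> U \<and> (q = (fst p + 1, snd p) \<or> q = (fst p, snd p + 1))}"

text \<open>This holds for squares with one extra vertex at the top right corner, and it is preserved
  when a vertex \<open>(i, j)\<close> with \<open>i + j\<close> minimal is deleted.\<close>

definition forward_closed :: "(int \<times> int) set \<Rightarrow> bool" where
  "forward_closed U \<longleftrightarrow>
    (\<forall>i j. (i, j) \<in> U \<and> (i - 1, j) \<in> U \<and> (i, j - 1) \<in> U \<longrightarrow> (i + 1, j) \<in> U \<or> (i, j + 1) \<in> U) \<and>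
    (\<forall>i j. (i, j) \<in> U \<and> (i + 1, j) \<in> U \<and> (i, j + 1) \<in> U \<longrightarrow> (i + 1, j + 1) \<in> U)"

lemma finite_grid_edges [simp]: "finite U \<Longrightarrow> finite (grid_edges U)"
  by (rule finite_subset[of _ "U \<times> U"]) (auto simp: grid_edges_def)

lemma not_in_Field_grid_edges: "v \<notin> U \<Longrightarrow> v \<notin> Field (grid_edges U)"
  by (auto simp: grid_edges_def Field_def)

lemma grid_edges_remove:
  "grid_edges U = grid_edges (U - {(i, j)}) \<union>
    {((i - 1, j), (i, j)), ((i, j - 1), (i, j)), ((i, j), (i + 1, j)), ((i, j), (i, j + 1))} \<inter> U \<times> U"
  by (auto simp: grid_edges_def)

context star_triangle_pair
begin

lemma transfers_grid_diagonal:
  assumes U: "finite U" "forward_closed U" "transfers U (grid_edges U)"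
  shows "\<lbrakk>(i, j) \<in> U; (i - 1, j) \<in> U; (i, j - 1) \<in> U\<rbrakk> \<Longrightarrow>
    transfers U (insert ((i - 1, j), (i, j - 1)) (grid_edges U))"
proof (induction "card {p \<in> U. i < fst p}" arbitrary: i j rule: less_induct)
  case less
  define P where "P = grid_edges (U - {(i, j)})"
  have P: "finite P" "(i, j) \<notin> Field P"
    using U(1) not_in_Field_grid_edges[of "(i, j)" "U - {(i, j)}"] by (simp_all add: P_def)
  have not_edge: "((x - 1, y), (x, y - 1)) \<notin> P" "((x, y + 1), (x + 1, y)) \<notin> P" for x y
    by (auto simp: P_def grid_edges_def)
  have edges: "grid_edges U = P \<union> ({((i - 1, j), (i, j)), ((i, j - 1), (i, j))} \<union>
      {((i, j), (i + 1, j)), ((i, j), (i, j + 1))} \<inter> U \<times> U)"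
    unfolding P_def using less.prems by (subst grid_edges_remove[of U i j]) auto
  consider (both) "(i + 1, j) \<in> U" "(i, j + 1) \<in> U"
    | (one) c where "c \<in> {(i + 1, j), (i, j + 1)}"
      "grid_edges U = P \<union> {((i - 1, j), (i, j)), ((i, j - 1), (i, j)), ((i, j), c)}"
    using less.prems U(2) edges unfolding forward_closed_def by blast
  then show ?case
  proof cases
    case both
    have ahead: "(i + 1, j + 1) \<in> U" using both less.prems U(2) by (auto simp: forward_closed_def)
    have "card {p \<in> U. i + 1 < fst p} < card {p \<in> U. i < fst p}"
    proof (rule psubset_card_mono)
      have "(i + 1, j) \<in> {p \<in> U. i < fst p}" "(i + 1, j) \<notin> {p \<in> U. i + 1 < fst p}"
        using both(1) by auto
      moreover have "{p \<in> U. i + 1 < fst p} \<subseteq> {p \<in> U. i < fst p}" by auto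
      ultimately show "{p \<in> U. i + 1 < fst p} \<subset> {p \<in> U. i < fst p}" by blast
    qed (use U(1) in simp)
    then have "transfers U (insert ((i, j + 1), (i + 1, j)) (grid_edges U))"
      using less.hyps[of "i + 1" "j + 1"] both ahead by simp
    moreover have "grid_edges U =
        P \<union> {((i - 1, j), (i, j)), ((i, j - 1), (i, j)), ((i, j), (i + 1, j)), ((i, j), (i, j + 1))}"
      using edges both less.prems by auto
    ultimately show ?thesis
      using transfers_shift_diagonal[of "(i, j)" U P "(i - 1, j)" "(i, j - 1)" "(i + 1, j)" "(i, j + 1)"]
        less.prems P not_edge by simp
  next
    case one
    then show ?thesis
      using transfers_absorb_diagonal[of "(i, j)" U P "(i - 1, j)" "(i, j - 1)" c]
        U(3) less.prems P not_edge by auto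
  qed
qed

lemma transfers_grid_remove:
  assumes U: "finite U" "(i, j) \<in> U" "(i - 1, j) \<notin> U" "(i, j - 1) \<notin> U" "forward_closed U"
    and closed: "forward_closed (U - {(i, j)})"
    and base: "transfers (U - {(i, j)}) (grid_edges (U - {(i, j)}))"
  shows "transfers U (grid_edges U)"
proof -
  define P where "P = grid_edges (U - {(i, j)})"
  have P: "finite P" "(i, j) \<notin> Field P"
    using U(1) not_in_Field_grid_edges[of "(i, j)" "U - {(i, j)}"] by (simp_all add: P_def)
  have edges: "grid_edges U = P \<union> {((i, j), (i + 1, j)), ((i, j), (i, j + 1))} \<inter> U \<times> U"
    unfolding P_def using U(3,4) by (subst grid_edges_remove[of U i j]) auto
  consider (both) "(i + 1, j) \<in> U" "(i, j + 1) \<in> U"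
    | (one) a where "a \<noteq> (i, j)" "grid_edges U = insert ((i, j), a) P"
    | (none) "grid_edges U = P"
  proof (cases "(i + 1, j) \<in> U")
    case True
    then show ?thesis
      using edges U(2) both one[of "(i + 1, j)"] by (cases "(i, j + 1) \<in> U") auto
  next
    case False
    then show ?thesis
      using edges U(2) none one[of "(i, j + 1)"] by (cases "(i, j + 1) \<in> U") auto
  qed
  then show ?thesis
  proof cases
    case both
    have "(i + 1, j + 1) \<in> U" using both U by (auto simp: forward_closed_def)
    then have "transfers (U - {(i, j)}) (insert ((i, j + 1), (i + 1, j)) P)"
      using transfers_grid_diagonal[of "U - {(i, j)}" "i + 1" "j + 1"] U(1) both closed base
      by (simp add: P_def)
    moreover have "((i, j + 1), (i + 1, j)) \<notin> P" by (auto simp: P_def grid_edges_def)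
    moreover have "grid_edges U = insert ((i, j), (i, j + 1)) (insert ((i, j), (i + 1, j)) P)"
      using edges both U(2) by auto
    ultimately show ?thesis using transfers_series[OF U(2) P] by simp
  next
    case one
    then show ?thesis using transfers_pendant[OF U(2) P] base by (simp add: P_def)
  next
    case none
    then show ?thesis using transfers_isolated[OF U(2) P(2)] base by (simp add: P_def)
  qed
qed

lemma transfers_empty: "transfers {} {}"
  by (simp add: transfers_def agree_def weighted_scaffold_def edge_product_def)

lemma transfers_grid: "finite U \<Longrightarrow> forward_closed U \<Longrightarrow> transfers U (grid_edges U)"
proof (induction "card U" arbitrary: U rule: less_induct)
  case less
  show ?case
  proof (cases "U = {}")
    case True
    then show ?thesis using transfers_empty by (simp add: grid_edges_def)
  next
    case False
    then obtain i j where ij: "(i, j) \<in> U" and least: "\<And>x y. (x, y) \<in> U \<Longrightarrow> i + j \<le> x + y"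
      using arg_min_if_finite[of U "\<lambda>(x, y). x + y"] less.prems(1)
      by (cases "arg_min_on (\<lambda>(x, y). x + y) U") (force simp: not_less)
    have "forward_closed (U - {(i, j)})"
      unfolding forward_closed_def
    proof (intro conjI allI impI)
      fix x y
      assume *: "(x, y) \<in> U - {(i, j)} \<and> (x - 1, y) \<in> U - {(i, j)} \<and> (x, y - 1) \<in> U - {(i, j)}"
      then have "(x + 1, y) \<noteq> (i, j)" "(x, y + 1) \<noteq> (i, j)" using least[of x y] by auto
      then show "(x + 1, y) \<in> U - {(i, j)} \<or> (x, y + 1) \<in> U - {(i, j)}"
        using * less.prems(2) unfolding forward_closed_def by blast
    next
      fix x y
      assume *: "(x, y) \<in> U - {(i, j)} \<and> (x + 1, y) \<in> U - {(i, j)} \<and> (x, y + 1) \<in> U - {(i, j)}"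
      then have "(x + 1, y + 1) \<noteq> (i, j)" using least[of x y] by auto
      then show "(x + 1, y + 1) \<in> U - {(i, j)}"
        using * less.prems(2) unfolding forward_closed_def by blast
    qed
    moreover from this have "transfers (U - {(i, j)}) (grid_edges (U - {(i, j)}))"
      using less.prems(1) ij by (intro less.hyps card_Diff1_less) auto
    ultimately show ?thesis
      using less.prems ij least[of "i - 1" j] least[of i "j - 1"]
      by (intro transfers_grid_remove[of U i j]) auto
  qed
qed

end

section \<open>Graph minors\<close>

definition linked :: "('u \<times> 'u) set \<Rightarrow> 'u set \<Rightarrow> ('u \<times> 'u) set" where
  "linked P S = (P \<union> P\<inverse>) \<inter> S \<times> S"

definition connected_in :: "('u \<times> 'u) set \<Rightarrow> 'u set \<Rightarrow> bool" where
  "connected_in P S \<longleftrightarrow> S \<noteq> {} \<and> S \<times> S \<subseteq> (linked P S)\<^sup>*"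

definition loopless_graph :: "'v set \<Rightarrow> 'e set \<Rightarrow> ('e \<Rightarrow> 'v \<times> 'v) \<Rightarrow> bool" where
  "loopless_graph V Ed ends \<longleftrightarrow> finite_graph V Ed ends \<and> (\<forall>e\<in>Ed. fst (ends e) \<noteq> snd (ends e))"

definition minor_model ::
    "'v set \<Rightarrow> 'e set \<Rightarrow> ('e \<Rightarrow> 'v \<times> 'v) \<Rightarrow> ('u \<times> 'u) set \<Rightarrow> ('v \<Rightarrow> 'u set) \<Rightarrow> ('e \<Rightarrow> 'u \<times> 'u) \<Rightarrow> bool" where
  "minor_model V Ed ends P B g \<longleftrightarrow>
    (\<forall>v\<in>V. connected_in P (B v)) \<and> disjoint_family_on B V \<and> inj_on g Ed \<and>
    (\<forall>e\<in>Ed. g e \<in> P \<and> g e \<in> B (fst (ends e)) \<times> B (snd (ends e)) \<union> B (snd (ends e)) \<times> B (fst (ends e)))"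

definition minor_weight ::
    "'v set \<Rightarrow> 'e set \<Rightarrow> ('v \<Rightarrow> 'u set) \<Rightarrow> ('e \<Rightarrow> 'u \<times> 'u) \<Rightarrow> ('e \<Rightarrow> 'x mat) \<Rightarrow> 'u \<times> 'u \<Rightarrow> 'x mat" where
  "minor_weight V Ed B g w p = (if p \<in> g ` Ed then w (inv_into Ed g p)
    else if \<exists>v\<in>V. p \<in> B v \<times> B v then id_mat else (\<lambda>_ _. 1))"

definition branch_colourings :: "'u set \<Rightarrow> 'v set \<Rightarrow> ('v \<Rightarrow> 'u set) \<Rightarrow> ('v \<Rightarrow> 'x) \<Rightarrow> ('u \<Rightarrow> 'x) set" where
  "branch_colourings U V B \<psi> = {\<phi> \<in> PiE U (\<lambda>_. UNIV). \<forall>v\<in>V. \<forall>q\<in>B v. \<phi> q = \<psi> v}"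

lemma card_branch_colourings:
  fixes \<psi> :: "'v \<Rightarrow> 'x::finite"
  assumes U: "finite U" "\<And>v. v \<in> V \<Longrightarrow> B v \<subseteq> U" and disj: "disjoint_family_on B V"
  shows "card (branch_colourings U V B \<psi>) = CARD('x) ^ card (U - \<Union>(B ` V))"
proof -
  let ?F = "\<lambda>q. {x. \<forall>v\<in>V. q \<in> B v \<longrightarrow> x = \<psi> v}"
  have "card (?F q) = (if q \<in> \<Union>(B ` V) then 1 else CARD('x))" for q
  proof (cases "q \<in> \<Union>(B ` V)")
    case True
    then obtain v where v: "v \<in> V" "q \<in> B v" by blast
    then have "u = v" if "u \<in> V" "q \<in> B u" for u
      using disj that by (auto simp: disjoint_family_on_def)
    then have "?F q = {\<psi> v}" using v by blast
    then show ?thesis using True by simp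
  next
    case False
    then have "?F q = UNIV" by blast
    then show ?thesis using False by simp
  qed
  moreover have "branch_colourings U V B \<psi> = PiE U ?F"
    using U(2) unfolding branch_colourings_def PiE_iff set_eq_iff mem_Collect_eq by blast
  ultimately have "card (branch_colourings U V B \<psi>) = (\<Prod>q\<in>U. if q \<in> \<Union>(B ` V) then 1 else CARD('x))"
    using U(1) by (simp add: card_PiE)
  also have "\<dots> = (\<Prod>q\<in>U - \<Union>(B ` V). CARD('x))"
    using U(1) by (intro prod.mono_neutral_cong_right) auto
  finally show ?thesis by simp
qed

locale graph_minor =
  fixes V :: "'v set" and Ed :: "'e set" and ends :: "'e \<Rightarrow> 'v \<times> 'v"
    and U :: "'u set" and P :: "('u \<times> 'u) set" and B :: "'v \<Rightarrow> 'u set" and g :: "'e \<Rightarrow> 'u \<times> 'u"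
  assumes loopless: "loopless_graph V Ed ends" and finite_host: "finite U" "finite P"
    and branch_subset: "v \<in> V \<Longrightarrow> B v \<subseteq> U" and model: "minor_model V Ed ends P B g"
begin

lemma ends_mem: "e \<in> Ed \<Longrightarrow> fst (ends e) \<in> V" "e \<in> Ed \<Longrightarrow> snd (ends e) \<in> V"
  using loopless by (auto simp: loopless_graph_def finite_graph_def)

lemma branch_unique: "u \<in> V \<Longrightarrow> v \<in> V \<Longrightarrow> q \<in> B u \<Longrightarrow> q \<in> B v \<Longrightarrow> u = v"
  using model unfolding minor_model_def disjoint_family_on_def by blast

lemma branch_nonempty: "v \<in> V \<Longrightarrow> B v \<noteq> {}"
  using model by (auto simp: minor_model_def connected_in_def)

lemma model_edge_cases:
  assumes "e \<in> Ed"
  obtains p q where "p \<in> B (fst (ends e))" "q \<in> B (snd (ends e))" "g e = (p, q) \<or> g e = (q, p)"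
  using model assms by (auto simp: minor_model_def)

lemma model_edge_not_in_branch:
  assumes "e \<in> Ed" "v \<in> V"
  shows "g e \<notin> B v \<times> B v"
proof
  assume in_branch: "g e \<in> B v \<times> B v"
  from \<open>e \<in> Ed\<close> have "fst (ends e) = v \<and> snd (ends e) = v"
  proof (rule model_edge_cases)
    fix p q assume "p \<in> B (fst (ends e))" "q \<in> B (snd (ends e))" "g e = (p, q) \<or> g e = (q, p)"
    with in_branch show ?thesis
      using branch_unique[OF ends_mem(1)[OF \<open>e \<in> Ed\<close>] \<open>v \<in> V\<close>, of p]
        branch_unique[OF ends_mem(2)[OF \<open>e \<in> Ed\<close>] \<open>v \<in> V\<close>, of q] by auto
  qed
  then show False using loopless \<open>e \<in> Ed\<close> by (auto simp: loopless_graph_def)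
qed

lemma edge_product_minor_weight:
  assumes sym: "\<And>e x y. e \<in> Ed \<Longrightarrow> w e x y = w e y x" and \<phi>: "\<phi> \<in> branch_colourings U V B \<psi>"
  shows "edge_product P (minor_weight V Ed B g w) \<phi> = (\<Prod>e\<in>Ed. w e (\<psi> (fst (ends e))) (\<psi> (snd (ends e))))"
proof -
  let ?W = "minor_weight V Ed B g w"
  have colour: "\<phi> q = \<psi> v" if "v \<in> V" "q \<in> B v" for v q
    using \<phi> that by (auto simp: branch_colourings_def)
  have g: "inj_on g Ed" "g ` Ed \<subseteq> P" using model by (auto simp: minor_model_def)
  have "edge_product P ?W \<phi> = (\<Prod>p\<in>g ` Ed. ?W p (\<phi> (fst p)) (\<phi> (snd p)))"
    unfolding edge_product_def
  proof (rule prod.mono_neutral_right[OF finite_host(2) g(2)], rule ballI)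
    fix p assume "p \<in> P - g ` Ed"
    then show "?W p (\<phi> (fst p)) (\<phi> (snd p)) = 1"
      using colour by (auto simp: minor_weight_def id_mat_def)
  qed
  also have "\<dots> = (\<Prod>e\<in>Ed. ?W (g e) (\<phi> (fst (g e))) (\<phi> (snd (g e))))"
    by (simp add: prod.reindex[OF g(1)])
  also have "\<dots> = (\<Prod>e\<in>Ed. w e (\<psi> (fst (ends e))) (\<psi> (snd (ends e))))"
  proof (rule prod.cong[OF refl])
    fix e assume e: "e \<in> Ed"
    obtain p q where pq: "p \<in> B (fst (ends e))" "q \<in> B (snd (ends e))" "g e = (p, q) \<or> g e = (q, p)"
      using e by (rule model_edge_cases)
    then have "\<phi> p = \<psi> (fst (ends e))" "\<phi> q = \<psi> (snd (ends e))" using colour ends_mem[OF e] by blast+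
    moreover have "?W (g e) = w e" using e g(1) by (simp add: minor_weight_def)
    ultimately show "?W (g e) (\<phi> (fst (g e))) (\<phi> (snd (g e))) =
        w e (\<psi> (fst (ends e))) (\<psi> (snd (ends e)))"
      using pq(3) sym[OF e, of "\<psi> (fst (ends e))"] by auto
  qed
  finally show ?thesis .
qed

lemma edge_product_minor_weight_eq_0:
  assumes "\<And>\<psi>. \<phi> \<notin> branch_colourings U V B \<psi>" "\<phi> \<in> PiE U (\<lambda>_. UNIV)"
  shows "edge_product P (minor_weight V Ed B g w) \<phi> = 0"
proof -
  define r where "r = (\<lambda>v. SOME q. q \<in> B v)"
  obtain v q where v: "v \<in> V" and q: "q \<in> B v" "\<phi> q \<noteq> \<phi> (r v)"
    using assms(1)[of "\<lambda>v. \<phi> (r v)"] assms(2) by (auto simp: branch_colourings_def)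
  have "r v \<in> B v" using branch_nonempty[OF v] by (simp add: r_def some_in_eq)
  then have "(r v, q) \<in> (linked P (B v))\<^sup>*"
    using model v q(1) by (auto simp: minor_model_def connected_in_def)
  then obtain a b where "(a, b) \<in> linked P (B v)" "\<phi> a \<noteq> \<phi> b"
    using q(2)
  proof (induction arbitrary: thesis rule: rtrancl_induct)
    case (step y z)
    then show ?case by (cases "\<phi> y = \<phi> z") auto
  qed simp
  then obtain p where "p \<in> P" "p = (a, b) \<or> p = (b, a)" "a \<in> B v" "b \<in> B v"
    unfolding linked_def by blast
  then have p: "p \<in> P" "p \<in> B v \<times> B v" "\<phi> (fst p) \<noteq> \<phi> (snd p)"
    using \<open>\<phi> a \<noteq> \<phi> b\<close> by auto
  then have "p \<notin> g ` Ed" using model_edge_not_in_branch[OF _ v] by (metis imageE)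
  moreover have "\<exists>v\<in>V. p \<in> B v \<times> B v" using p(2) v by blast
  ultimately have "minor_weight V Ed B g w p = id_mat" by (simp add: minor_weight_def)
  then show ?thesis
    unfolding edge_product_def using p finite_host(2)
    by (intro prod_zero bexI[of _ p]) (simp_all add: id_mat_def)
qed

lemma scaffold0_minor:
  fixes w :: "'e \<Rightarrow> ('x::finite) mat"
  assumes sym: "\<And>e x y. e \<in> Ed \<Longrightarrow> w e x y = w e y x"
  shows "scaffold0 U P id (minor_weight V Ed B g w) =
    of_nat (CARD('x) ^ card (U - \<Union>(B ` V))) * scaffold0 V Ed ends w"
proof -
  let ?W = "minor_weight V Ed B g w" and ?C = "branch_colourings U V B :: ('v \<Rightarrow> 'x) \<Rightarrow> _"
  let ?\<Psi> = "PiE V (\<lambda>_. UNIV :: 'x set)"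
  have fin: "finite (PiE U (\<lambda>_. UNIV :: 'x set))" "finite ?\<Psi>"
    using finite_host loopless by (auto simp: loopless_graph_def finite_graph_def intro!: finite_PiE)
  have C_subset: "?C \<psi> \<subseteq> PiE U (\<lambda>_. UNIV)" for \<psi> by (auto simp: branch_colourings_def)
  have C_restrict: "?C (restrict \<psi> V) = ?C \<psi>" for \<psi> by (auto simp: branch_colourings_def)
  have C_disjoint: "?C \<psi> \<inter> ?C \<psi>' = {}" if \<psi>: "\<psi> \<in> ?\<Psi>" "\<psi>' \<in> ?\<Psi>" "\<psi> \<noteq> \<psi>'" for \<psi> \<psi>'
  proof -
    obtain v where v: "v \<in> V" "\<psi> v \<noteq> \<psi>' v" using PiE_ext[OF \<psi>(1,2)] \<psi>(3) by blast
    obtain q where q: "q \<in> B v" using branch_nonempty[OF v(1)] by blast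
    have "\<phi> q = \<psi> v \<and> \<phi> q = \<psi>' v" if "\<phi> \<in> ?C \<psi> \<inter> ?C \<psi>'" for \<phi>
      using that v(1) q unfolding branch_colourings_def by blast
    then show ?thesis using v(2) by force
  qed
  have "scaffold0 U P id ?W = (\<Sum>\<phi>\<in>\<Union>(?C ` ?\<Psi>). edge_product P ?W \<phi>)"
    unfolding scaffold0_eq_sum_edge_product
  proof (rule sum.mono_neutral_right[OF fin(1)], use C_subset in blast, rule ballI)
    fix \<phi> assume \<phi>: "\<phi> \<in> PiE U (\<lambda>_. UNIV) - \<Union>(?C ` ?\<Psi>)"
    have "\<phi> \<notin> ?C \<psi>" for \<psi>
      using \<phi> C_restrict[of \<psi>] by (auto dest: bspec[of _ _ "restrict \<psi> V"])
    then show "edge_product P ?W \<phi> = 0" using \<phi> by (intro edge_product_minor_weight_eq_0) auto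
  qed
  also have "\<dots> = (\<Sum>\<psi>\<in>?\<Psi>. \<Sum>\<phi>\<in>?C \<psi>. edge_product P ?W \<phi>)"
    using fin C_subset C_disjoint by (intro sum.UNION_disjoint ballI) (auto intro: finite_subset)
  also have "\<dots> = (\<Sum>\<psi>\<in>?\<Psi>. of_nat (card (?C \<psi>)) * (\<Prod>e\<in>Ed. w e (\<psi> (fst (ends e))) (\<psi> (snd (ends e)))))"
    by (simp add: edge_product_minor_weight[where w = w, OF sym])
  also have "\<dots> = of_nat (CARD('x) ^ card (U - \<Union>(B ` V))) * scaffold0 V Ed ends w"
    using model finite_host(1) branch_subset
    by (simp add: card_branch_colourings minor_model_def scaffold0_def sum_distrib_left)
  finally show ?thesis .
qed

end

lemma (in star_triangle_pair) scaffold0_eq_of_minor: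
  assumes minor: "graph_minor V Ed ends U P B g" and host: "transfers U P"
    and w: "\<And>e. e \<in> Ed \<Longrightarrow> (w e, w' e) \<in> \<A>"
  shows "scaffold0 V Ed ends w = scaffold0 V Ed ends w'"
proof -
  interpret graph_minor V Ed ends U P B g by (rule minor)
  have "(minor_weight V Ed B g w p, minor_weight V Ed B g w' p) \<in> \<A>" for p
    using w inv_into_into[of p g Ed] by (simp add: minor_weight_def id_mem ones_mem)
  then have "scaffold0 U P id (minor_weight V Ed B g w) = scaffold0 U P id (minor_weight V Ed B g w')"
    by (rule transfersD[OF host])
  moreover have "w e x y = w e y x" "w' e x' y' = w' e y' x'" if "e \<in> Ed" for e x y x' y'
    using w[OF that] symmetric_left symmetric_right by blast+
  ultimately show ?thesis
    by (simp add: scaffold0_minor card_eq)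
qed

lemma linked_rtrancl_mono: "S \<subseteq> T \<Longrightarrow> (p, q) \<in> (linked P S)\<^sup>* \<Longrightarrow> (p, q) \<in> (linked P T)\<^sup>*"
  by (rule rtrancl_mono[THEN subsetD, rotated]) (auto simp: linked_def)

lemma linked_rtrancl_sym: "(p, q) \<in> (linked P S)\<^sup>* \<Longrightarrow> (q, p) \<in> (linked P S)\<^sup>*"
  by (rule symD[OF sym_rtrancl]) (auto simp: linked_def sym_def)

lemma connected_inI:
  assumes "s \<in> S" "\<And>q. q \<in> S \<Longrightarrow> (s, q) \<in> (linked P S)\<^sup>*"
  shows "connected_in P S"
  unfolding connected_in_def using assms by (blast intro: linked_rtrancl_sym rtrancl_trans)

lemma connected_in_Union:
  assumes S: "connected_in P S" and F: "\<And>T. T \<in> F \<Longrightarrow> connected_in P T \<and> S \<subseteq> T"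
  shows "connected_in P (S \<union> \<Union>F)"
proof -
  obtain s where s: "s \<in> S" using S by (auto simp: connected_in_def)
  show ?thesis
  proof (rule connected_inI[of s])
    fix q assume "q \<in> S \<union> \<Union>F"
    then obtain T where T: "connected_in P T" "s \<in> T" "q \<in> T" "T \<subseteq> S \<union> \<Union>F" using S F s by blast
    then have "(s, q) \<in> (linked P T)\<^sup>*" by (auto simp: connected_in_def)
    then show "(s, q) \<in> (linked P (S \<union> \<Union>F))\<^sup>*" using T(4) by (rule linked_rtrancl_mono[rotated])
  qed (use s in blast)
qed

lemma connected_in_rtrancl_Image:
  assumes S: "connected_in P S" "S \<subseteq> T"
  shows "connected_in P ((linked P T)\<^sup>* `` S)" (is "connected_in P ?C")
proof -
  have S_C: "S \<subseteq> ?C" by blast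
  have walk_in_C: "(a, z) \<in> (linked P ?C)\<^sup>*" if "a \<in> S" "(a, z) \<in> (linked P T)\<^sup>*" for a z
    using that(2)
  proof (induction rule: rtrancl_induct)
    case (step y z)
    then have "y \<in> ?C" "z \<in> ?C" using \<open>a \<in> S\<close> by (blast intro: rtrancl_into_rtrancl)+
    with step show ?case by (auto simp: linked_def intro: rtrancl_into_rtrancl)
  qed simp
  obtain s where s: "s \<in> S" using S by (auto simp: connected_in_def)
  show ?thesis
  proof (rule connected_inI[of s])
    fix z assume "z \<in> ?C"
    then obtain a where a: "a \<in> S" "(a, z) \<in> (linked P ?C)\<^sup>*" using walk_in_C by blast
    moreover have "(s, a) \<in> (linked P ?C)\<^sup>*"
      using S(1) s a(1) by (intro linked_rtrancl_mono[OF S_C]) (auto simp: connected_in_def)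
    ultimately show "(s, z) \<in> (linked P ?C)\<^sup>*" by simp
  qed (use s S_C in blast)
qed

lemma connected_in_extend_along_walk:
  assumes S: "connected_in P S" and walk: "(x, y) \<in> (linked P W)\<^sup>*" "x \<in> S" "y \<in> T"
    and disj: "S \<inter> T = {}" and apart: "\<And>p q. p \<in> S \<Longrightarrow> q \<in> T \<Longrightarrow> (p, q) \<notin> P \<union> P\<inverse>"
  shows "\<exists>Q f. Q \<subseteq> W - S - T \<and> connected_in P (S \<union> Q) \<and> f \<in> P \<and> f \<in> Q \<times> T \<union> T \<times> Q"
proof -
  define C where "C = (linked P (S \<union> (W - T)))\<^sup>* `` S"
  have S_C: "S \<subseteq> C" by (auto simp: C_def)
  have C_W: "C \<subseteq> S \<union> (W - T)"
    unfolding C_def by (auto simp: linked_def elim: rtranclE)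
  have "connected_in P C" unfolding C_def using S by (rule connected_in_rtrancl_Image) blast
  moreover have "S \<union> (C - S) = C" using S_C by blast
  moreover have "\<exists>q\<in>C. \<exists>b\<in>T. (q, b) \<in> P \<union> P\<inverse>"
  proof (rule ccontr)
    assume no_edge: "\<not> ?thesis"
    have "z \<in> C" if "(x, z) \<in> (linked P W)\<^sup>*" for z
      using that
    proof (induction rule: rtrancl_induct)
      case base
      then show ?case using walk(2) S_C by blast
    next
      case (step y z)
      then have "(y, z) \<in> linked P (S \<union> (W - T))" using C_W no_edge by (auto simp: linked_def)
      with step show ?case unfolding C_def by (blast intro: rtrancl_into_rtrancl)
    qed
    then show False using walk disj C_W by blast
  qed
  then obtain f where "f \<in> P" "f \<in> (C - S) \<times> T \<union> T \<times> (C - S)"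
    using apart by blast
  ultimately show ?thesis using C_W by (intro exI[of _ "C - S"] exI[of _ f]) auto
qed

lemma minor_model_of_separated:
  fixes S :: "'v \<Rightarrow> 'u set" and W :: "'e \<Rightarrow> 'u set"
  assumes loopless: "loopless_graph V Ed ends"
    and S: "\<And>v. v \<in> V \<Longrightarrow> connected_in P (S v)" "disjoint_family_on S V"
    and S_apart: "\<And>u v p q. \<lbrakk>u \<in> V; v \<in> V; u \<noteq> v; p \<in> S u; q \<in> S v\<rbrakk> \<Longrightarrow> (p, q) \<notin> P"
    and walk: "\<And>e. e \<in> Ed \<Longrightarrow> \<exists>x\<in>S (fst (ends e)). \<exists>y\<in>S (snd (ends e)). (x, y) \<in> (linked P (W e))\<^sup>*"
    and W_S: "\<And>e v. \<lbrakk>e \<in> Ed; v \<in> V; v \<noteq> fst (ends e); v \<noteq> snd (ends e)\<rbrakk> \<Longrightarrow> W e \<inter> S v = {}"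
    and W: "disjoint_family_on W Ed"
  shows "\<exists>B g. minor_model V Ed ends P B g \<and> (\<forall>v\<in>V. B v \<subseteq> S v \<union> \<Union>(W ` Ed))"
proof -
  let ?a = "\<lambda>e. fst (ends e)" and ?b = "\<lambda>e. snd (ends e)"
  have ends: "?a e \<in> V" "?b e \<in> V" "?a e \<noteq> ?b e" if "e \<in> Ed" for e
    using loopless that by (auto simp: loopless_graph_def finite_graph_def)
  have "\<exists>Q f. Q \<subseteq> W e - S (?a e) - S (?b e) \<and> connected_in P (S (?a e) \<union> Q) \<and>
      f \<in> P \<and> f \<in> Q \<times> S (?b e) \<union> S (?b e) \<times> Q" if e: "e \<in> Ed" for e
  proof -
    obtain x y where xy: "(x, y) \<in> (linked P (W e))\<^sup>*" "x \<in> S (?a e)" "y \<in> S (?b e)"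
      using walk[OF e] by blast
    have disj: "S (?a e) \<inter> S (?b e) = {}"
      using S(2) ends[OF e] by (rule disjoint_family_onD)
    have apart: "(p, q) \<notin> P \<union> P\<inverse>" if "p \<in> S (?a e)" "q \<in> S (?b e)" for p q
      using S_apart[OF ends(1,2)[OF e]] S_apart[OF ends(2,1)[OF e]] ends(3)[OF e] that by auto
    show ?thesis
      by (rule connected_in_extend_along_walk[OF S(1)[OF ends(1)[OF e]] xy disj apart])
  qed
  then obtain Q g where Q: "\<And>e. e \<in> Ed \<Longrightarrow> Q e \<subseteq> W e - S (?a e) - S (?b e)"
    and S_Q: "\<And>e. e \<in> Ed \<Longrightarrow> connected_in P (S (?a e) \<union> Q e)"
    and g: "\<And>e. e \<in> Ed \<Longrightarrow> g e \<in> P" "\<And>e. e \<in> Ed \<Longrightarrow> g e \<in> Q e \<times> S (?b e) \<union> S (?b e) \<times> Q e"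
    by metis
  have Q_S: "Q e \<inter> S v = {}" if "e \<in> Ed" "v \<in> V" for e v using Q W_S that by blast
  have Q_Q: "Q e \<inter> Q f = {}" if "e \<in> Ed" "f \<in> Ed" "e \<noteq> f" for e f
    using Q W that unfolding disjoint_family_on_def by blast
  define B where "B = (\<lambda>v. S v \<union> \<Union>((\<lambda>e. S v \<union> Q e) ` {e \<in> Ed. ?a e = v}))"
  have "connected_in P (B v)" if "v \<in> V" for v
    unfolding B_def using S(1)[OF that] S_Q by (intro connected_in_Union) auto
  moreover have "disjoint_family_on B V"
    using S(2) Q_S Q_Q unfolding disjoint_family_on_def B_def by blast
  moreover have "inj_on g Ed"
  proof (rule inj_onI, rule ccontr)
    fix e f assume "e \<in> Ed" "f \<in> Ed" "g e = g f" "e \<noteq> f"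
    then show False
      using g(2)[of e] g(2)[of f] Q_Q[of e f] Q_S[of e "?b f"] Q_S[of f "?b e"]
        ends(2)[of e] ends(2)[of f]
      by auto
  qed
  moreover have "g e \<in> B (?a e) \<times> B (?b e) \<union> B (?b e) \<times> B (?a e)" if "e \<in> Ed" for e
    using g(2)[OF that] that by (auto simp: B_def)
  moreover have "B v \<subseteq> S v \<union> \<Union>(W ` Ed)" for v using Q by (auto simp: B_def)
  ultimately show ?thesis using g(1) unfolding minor_model_def by blast
qed

section \<open>Planar graphs as grid minors\<close>

definition grid_ball :: "int \<Rightarrow> int \<times> int \<Rightarrow> (int \<times> int) set" where
  "grid_ball k p = {q. \<bar>fst p - fst q\<bar> \<le> k \<and> \<bar>snd p - snd q\<bar> \<le> k}"

definition grid_point :: "real^2 \<Rightarrow> int \<times> int" where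
  "grid_point z = (\<lfloor>z $ 1\<rfloor>, \<lfloor>z $ 2\<rfloor>)"

definition grid_tube :: "(real \<Rightarrow> real^2) \<Rightarrow> real set \<Rightarrow> (int \<times> int) set" where
  "grid_tube \<gamma> X = (\<Union>x\<in>X. grid_ball 1 (grid_point (\<gamma> x)))"

lemma grid_ball_self: "0 \<le> k \<Longrightarrow> p \<in> grid_ball k p"
  by (simp add: grid_ball_def)

lemma grid_ball_commute: "q \<in> grid_ball k p \<longleftrightarrow> p \<in> grid_ball k q"
  by (auto simp: grid_ball_def)

lemma grid_ball_trans: "q \<in> grid_ball k p \<Longrightarrow> r \<in> grid_ball m q \<Longrightarrow> r \<in> grid_ball (k + m) p"
  by (auto simp: grid_ball_def)

lemma finite_grid_ball [simp]: "finite (grid_ball k p)"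
  by (rule finite_subset[of _ "{fst p - k..fst p + k} \<times> {snd p - k..snd p + k}"])
    (auto simp: grid_ball_def)

lemma grid_edge_grid_ball: "(p, q) \<in> grid_edges U \<Longrightarrow> q \<in> grid_ball 1 p"
  by (auto simp: grid_edges_def grid_ball_def)

lemma connected_in_grid_ball:
  assumes "0 \<le> k"
  shows "connected_in (grid_edges UNIV) (grid_ball k p)"
proof (rule connected_inI[of p])
  fix q assume "q \<in> grid_ball k p"
  then show "(p, q) \<in> (linked (grid_edges UNIV) (grid_ball k p))\<^sup>*"
  proof (induction "nat (\<bar>fst q - fst p\<bar> + \<bar>snd q - snd p\<bar>)" arbitrary: q rule: less_induct)
    case less
    obtain i j x y where p: "p = (i, j)" and q: "q = (x, y)" by (cases p, cases q)
    consider (centre) "q = p" | (horizontal) "x \<noteq> i" | (vertical) "x = i" "y \<noteq> j" using p q by blast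
    then show ?case
    proof cases
      case centre
      then show ?thesis by simp
    next
      case horizontal
      then show ?thesis
        using less.prems p q
        by (intro rtrancl_into_rtrancl[OF less.hyps[of "(x - sgn (x - i), y)"]])
          (auto simp: sgn_if linked_def grid_edges_def grid_ball_def)
    next
      case vertical
      then show ?thesis
        using less.prems p q
        by (intro rtrancl_into_rtrancl[OF less.hyps[of "(x, y - sgn (y - j))"]])
          (auto simp: sgn_if linked_def grid_edges_def grid_ball_def)
    qed
  qed
qed (use assms in \<open>simp add: grid_ball_self\<close>)

lemma grid_point_in_grid_ball:
  assumes "dist z z' < of_int k"
  shows "grid_point z' \<in> grid_ball k (grid_point z)"
proof -
  have "\<bar>z $ i - z' $ i\<bar> < of_int k" for i
    using component_le_norm_cart[of "z - z'" i] assms by (simp add: dist_norm)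
  from this[of 1] this[of 2] show ?thesis
    unfolding grid_ball_def grid_point_def mem_Collect_eq fst_conv snd_conv by linarith
qed

lemma dist_le_of_grid_point_in_grid_ball:
  assumes "grid_point z' \<in> grid_ball k (grid_point z)"
  shows "dist z z' \<le> 2 * (of_int k + 1)"
proof -
  have "\<bar>z $ 1 - z' $ 1\<bar> \<le> of_int k + 1" "\<bar>z $ 2 - z' $ 2\<bar> \<le> of_int k + 1"
    using assms unfolding grid_ball_def grid_point_def mem_Collect_eq fst_conv snd_conv by linarith+
  then show ?thesis
    using norm_le_l1_cart[of "z - z'"] by (simp add: sum_2 dist_norm)
qed

lemma grid_balls_apart:
  assumes "2 * (of_int (k + m) + 2) < dist z z'"
    and "p \<in> grid_ball k (grid_point z)" "q \<in> grid_ball m (grid_point z')"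
  shows "q \<notin> grid_ball 1 p"
proof
  assume "q \<in> grid_ball 1 p"
  with assms(2) have "q \<in> grid_ball (k + 1) (grid_point z)" by (rule grid_ball_trans)
  moreover have "grid_point z' \<in> grid_ball m q" using assms(3) by (simp add: grid_ball_commute)
  ultimately have "grid_point z' \<in> grid_ball (k + 1 + m) (grid_point z)" by (rule grid_ball_trans)
  from dist_le_of_grid_point_in_grid_ball[OF this] assms(1) show False by simp
qed

lemma finite_grid_point_image:
  assumes "bounded K"
  shows "finite (grid_point ` K)"
proof -
  obtain M where M: "\<And>z. z \<in> K \<Longrightarrow> norm z \<le> M" using assms unfolding bounded_iff by blast
  have "grid_point z \<in> grid_ball (\<lceil>M\<rceil> + 1) (grid_point 0)" if "z \<in> K" for z
  proof (rule grid_point_in_grid_ball)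
    show "dist 0 z < of_int (\<lceil>M\<rceil> + 1)" using M[OF that] by simp linarith
  qed
  then show ?thesis by (intro finite_subset[OF _ finite_grid_ball]) blast
qed

lemma grid_balls_disjoint:
  assumes "2 * (of_int (k + m) + 2) < dist z z'"
  shows "grid_ball k (grid_point z) \<inter> grid_ball m (grid_point z') = {}"
  using grid_balls_apart[OF assms] grid_ball_self[of 1] by fastforce

lemma finite_grid_tube:
  assumes "continuous_on X \<gamma>" "compact X"
  shows "finite (grid_tube \<gamma> X)"
proof -
  have "finite (grid_point ` \<gamma> ` X)"
    using assms by (intro finite_grid_point_image compact_imp_bounded compact_continuous_image)
  moreover have "grid_tube \<gamma> X = (\<Union>q\<in>grid_point ` \<gamma> ` X. grid_ball 1 q)" by (auto simp: grid_tube_def)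
  ultimately show ?thesis by (simp only: finite_UN_I finite_grid_ball)
qed

lemma linked_grid_tube:
  assumes cont: "continuous_on {s..t} \<gamma>" and "s \<le> t"
  shows "(grid_point (\<gamma> s), grid_point (\<gamma> t)) \<in> (linked (grid_edges UNIV) (grid_tube \<gamma> {s..t}))\<^sup>*"
    (is "_ \<in> ?walks")
proof (rule connected_equivalence_relation[of "{s..t}" s t
      "\<lambda>x y. (grid_point (\<gamma> x), grid_point (\<gamma> y)) \<in> ?walks"])
  fix x assume x: "x \<in> {s..t}"
  define T where "T = {s..t} \<inter> \<gamma> -` ball (\<gamma> x) 1"
  have "openin (top_of_set {s..t}) T"
    unfolding T_def by (rule continuous_openin_preimage_gen[OF cont]) simp
  moreover have "(grid_point (\<gamma> x), grid_point (\<gamma> y)) \<in> ?walks" if "y \<in> T" for y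
  proof (rule linked_rtrancl_mono)
    show "grid_ball 1 (grid_point (\<gamma> x)) \<subseteq> grid_tube \<gamma> {s..t}" using x by (auto simp: grid_tube_def)
    have "grid_point (\<gamma> y) \<in> grid_ball 1 (grid_point (\<gamma> x))"
      using that by (intro grid_point_in_grid_ball) (simp add: T_def)
    then show "(grid_point (\<gamma> x), grid_point (\<gamma> y)) \<in>
        (linked (grid_edges UNIV) (grid_ball 1 (grid_point (\<gamma> x))))\<^sup>*"
      using connected_in_grid_ball[of 1 "grid_point (\<gamma> x)"] grid_ball_self[of 1 "grid_point (\<gamma> x)"]
      by (auto simp: connected_in_def)
  qed
  ultimately show "\<exists>T. openin (top_of_set {s..t}) T \<and> x \<in> T \<and>
      (\<forall>y\<in>T. (grid_point (\<gamma> x), grid_point (\<gamma> y)) \<in> ?walks)"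
    using x by (intro exI[of _ T]) (simp add: T_def)
qed (use \<open>s \<le> t\<close> in \<open>simp_all add: linked_rtrancl_sym\<close>)

lemma grid_minor_of_widely_separated_arcs:
  fixes p :: "'v \<Rightarrow> real^2" and \<gamma> :: "'e \<Rightarrow> real \<Rightarrow> real^2" and k :: int
  assumes loopless: "loopless_graph V Ed ends" and k: "1 \<le> k"
    and vertices: "\<And>u v. \<lbrakk>u \<in> V; v \<in> V; u \<noteq> v\<rbrakk> \<Longrightarrow> 10 * of_int k \<le> dist (p u) (p v)"
    and arc_vertex: "\<And>e v x. \<lbrakk>e \<in> Ed; v \<in> V; v \<noteq> fst (ends e); v \<noteq> snd (ends e); x \<in> {s e..t e}\<rbrakk> \<Longrightarrow>
      10 * of_int k \<le> dist (\<gamma> e x) (p v)"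
    and arcs: "\<And>e f x y. \<lbrakk>e \<in> Ed; f \<in> Ed; e \<noteq> f; x \<in> {s e..t e}; y \<in> {s f..t f}\<rbrakk> \<Longrightarrow>
      10 \<le> dist (\<gamma> e x) (\<gamma> f y)"
    and cont: "\<And>e. e \<in> Ed \<Longrightarrow> continuous_on {s e..t e} (\<gamma> e)" and le: "\<And>e. e \<in> Ed \<Longrightarrow> s e \<le> t e"
    and near: "\<And>e. e \<in> Ed \<Longrightarrow> dist (p (fst (ends e))) (\<gamma> e (s e)) < of_int k"
      "\<And>e. e \<in> Ed \<Longrightarrow> dist (p (snd (ends e))) (\<gamma> e (t e)) < of_int k"
  shows "\<exists>B g. minor_model V Ed ends (grid_edges UNIV) B g \<and> (\<forall>v\<in>V. finite (B v))"
proof -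
  define S where "S = (\<lambda>v. grid_ball k (grid_point (p v)))"
  define W where "W = (\<lambda>e. grid_tube (\<gamma> e) {s e..t e})"
  have vertices': "2 * (of_int (k + k) + 2) < dist (p u) (p v)" if "u \<in> V" "v \<in> V" "u \<noteq> v" for u v
    using vertices[OF that] k by simp
  have "\<exists>B g. minor_model V Ed ends (grid_edges UNIV) B g \<and> (\<forall>v\<in>V. B v \<subseteq> S v \<union> \<Union>(W ` Ed))"
  proof (rule minor_model_of_separated[OF loopless])
    show "connected_in (grid_edges UNIV) (S v)" for v
      unfolding S_def using k by (intro connected_in_grid_ball) simp
    show "disjoint_family_on S V"
      unfolding disjoint_family_on_def S_def using grid_balls_disjoint[OF vertices'] by blast
    show "(a, b) \<notin> grid_edges UNIV" if "u \<in> V" "v \<in> V" "u \<noteq> v" "a \<in> S u" "b \<in> S v" for u v a b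
      using grid_balls_apart[OF vertices'[OF that(1-3)]] that(4,5) grid_edge_grid_ball unfolding S_def
      by blast
    show "\<exists>x\<in>S (fst (ends e)). \<exists>y\<in>S (snd (ends e)). (x, y) \<in> (linked (grid_edges UNIV) (W e))\<^sup>*"
      if "e \<in> Ed" for e
      using linked_grid_tube[OF cont[OF that] le[OF that]] near[OF that, THEN grid_point_in_grid_ball]
      unfolding S_def W_def by blast
    show "W e \<inter> S v = {}" if "e \<in> Ed" "v \<in> V" "v \<noteq> fst (ends e)" "v \<noteq> snd (ends e)" for e v
    proof -
      have "2 * (of_int (1 + k) + 2) < dist (\<gamma> e x) (p v)" if "x \<in> {s e..t e}" for x
        using arc_vertex[OF \<open>e \<in> Ed\<close> \<open>v \<in> V\<close> \<open>v \<noteq> fst (ends e)\<close> \<open>v \<noteq> snd (ends e)\<close> that] k by simp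
      from grid_balls_disjoint[OF this] show ?thesis unfolding W_def S_def grid_tube_def by blast
    qed
    have "2 * (of_int (1 + 1) + 2) < dist (\<gamma> e x) (\<gamma> f y)"
      if "e \<in> Ed" "f \<in> Ed" "e \<noteq> f" "x \<in> {s e..t e}" "y \<in> {s f..t f}" for e f x y
      using arcs[OF that] by simp
    from grid_balls_disjoint[OF this] show "disjoint_family_on W Ed"
      unfolding disjoint_family_on_def W_def grid_tube_def by blast
  qed
  moreover have "finite (S v \<union> \<Union>(W ` Ed))" for v
    using loopless cont
    by (auto simp: S_def W_def loopless_graph_def finite_graph_def intro!: finite_grid_tube)
  ultimately show ?thesis by (blast intro: finite_subset)
qed

lemma grid_minor_of_separated_arcs:
  fixes p :: "'v \<Rightarrow> real^2" and \<gamma> :: "'e \<Rightarrow> real \<Rightarrow> real^2"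
  assumes loopless: "loopless_graph V Ed ends" and pos: "0 < \<rho>" "0 < \<delta>"
    and vertices: "\<And>u v. \<lbrakk>u \<in> V; v \<in> V; u \<noteq> v\<rbrakk> \<Longrightarrow> 10 * \<rho> \<le> dist (p u) (p v)"
    and arc_vertex: "\<And>e v x. \<lbrakk>e \<in> Ed; v \<in> V; v \<noteq> fst (ends e); v \<noteq> snd (ends e); x \<in> {s e..t e}\<rbrakk> \<Longrightarrow>
      10 * \<rho> \<le> dist (\<gamma> e x) (p v)"
    and arcs: "\<And>e f x y. \<lbrakk>e \<in> Ed; f \<in> Ed; e \<noteq> f; x \<in> {s e..t e}; y \<in> {s f..t f}\<rbrakk> \<Longrightarrow>
      \<delta> \<le> dist (\<gamma> e x) (\<gamma> f y)"
    and cont: "\<And>e. e \<in> Ed \<Longrightarrow> continuous_on {s e..t e} (\<gamma> e)" and le: "\<And>e. e \<in> Ed \<Longrightarrow> s e \<le> t e"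
    and near: "\<And>e. e \<in> Ed \<Longrightarrow> dist (p (fst (ends e))) (\<gamma> e (s e)) < \<rho>"
      "\<And>e. e \<in> Ed \<Longrightarrow> dist (p (snd (ends e))) (\<gamma> e (t e)) < \<rho>"
  shows "\<exists>B g. minor_model V Ed ends (grid_edges UNIV) B g \<and> (\<forall>v\<in>V. finite (B v))"
proof -
  define k where "k = max 1 \<lceil>10 * \<rho> / \<delta>\<rceil>"
  define N where "N = of_int k / \<rho>"
  have k: "1 \<le> k" "10 * \<rho> / \<delta> \<le> of_int k" unfolding k_def by linarith+
  have N: "N > 0" "N * \<rho> = of_int k" "10 \<le> N * \<delta>"
    using pos k by (auto simp: N_def field_simps)
  have dist_scale: "dist (N *\<^sub>R z) (N *\<^sub>R z') = N * dist z z'" for z z' :: "real^2"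
    using N(1) by (simp add: dist_norm flip: scaleR_diff_right)
  have far: "10 * of_int k \<le> N * a" if "10 * \<rho> \<le> a" for a
    using mult_left_mono[OF that, of N] N(1) by (simp flip: N(2))
  have near': "N * a < of_int k" if "a < \<rho>" for a
    using mult_strict_left_mono[OF that N(1)] N(2) by simp
  show ?thesis
  proof (rule grid_minor_of_widely_separated_arcs[OF loopless k(1),
        where p = "\<lambda>v. N *\<^sub>R p v" and \<gamma> = "\<lambda>e x. N *\<^sub>R \<gamma> e x" and s = s and t = t], unfold dist_scale)
    show "10 \<le> N * dist (\<gamma> e x) (\<gamma> f y)"
      if "e \<in> Ed" "f \<in> Ed" "e \<noteq> f" "x \<in> {s e..t e}" "y \<in> {s f..t f}" for e f x y
      using mult_left_mono[OF arcs[OF that] less_imp_le[OF N(1)]] N(3) by linarith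
  qed (use vertices arc_vertex far cont le near near' in \<open>auto intro: continuous_intros\<close>)
qed

lemma finite_family_separated:
  fixes S T :: "'i \<Rightarrow> 'a::heine_borel set"
  assumes "finite I" "\<And>i. i \<in> I \<Longrightarrow> compact (S i) \<and> closed (T i) \<and> S i \<inter> T i = {}"
  shows "\<exists>\<delta>>0. \<forall>i\<in>I. \<forall>x\<in>S i. \<forall>y\<in>T i. \<delta> \<le> dist x y"
  using assms
proof (induction rule: finite_induct)
  case empty
  show ?case by (auto intro: exI[of _ 1])
next
  case (insert i I)
  obtain \<delta>1 where \<delta>1: "\<delta>1 > 0" "\<forall>i\<in>I. \<forall>x\<in>S i. \<forall>y\<in>T i. \<delta>1 \<le> dist x y" using insert by auto
  obtain \<delta>2 where \<delta>2: "\<delta>2 > 0" "\<forall>x\<in>S i. \<forall>y\<in>T i. \<delta>2 \<le> dist x y"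
    using separate_compact_closed[of "S i" "T i"] insert.prems by auto
  show ?case using \<delta>1 \<delta>2 by (intro exI[of _ "min \<delta>1 \<delta>2"]) (auto simp: min_le_iff_disj)
qed

lemma path_trim:
  fixes c :: "real \<Rightarrow> 'a::metric_space"
  assumes "continuous_on {0..1} c" "0 < \<epsilon>"
  shows "\<exists>s t. 0 < s \<and> s < t \<and> t < 1 \<and> dist (c 0) (c s) < \<epsilon> \<and> dist (c 1) (c t) < \<epsilon>"
proof -
  have "uniformly_continuous_on {0..1} c" using assms(1) by (rule compact_uniformly_continuous) simp
  then obtain d where d: "d > 0"
    "\<And>x y. x \<in> {0..1} \<Longrightarrow> y \<in> {0..1} \<Longrightarrow> dist x y < d \<Longrightarrow> dist (c x) (c y) < \<epsilon>"
    using assms(2) unfolding uniformly_continuous_on_def by blast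
  define s where "s = min (d / 2) (1 / 3)"
  have s: "0 < s" "s \<le> 1 / 3" "s < d" using d(1) by (auto simp: s_def min_def)
  then have "dist (c 0) (c s) < \<epsilon>" "dist (c 1) (c (1 - s)) < \<epsilon>"
    using d(2)[of 0 s] d(2)[of 1 "1 - s"] by (auto simp: dist_real_def)
  then show ?thesis using s by (intro exI[of _ s] exI[of _ "1 - s"]) auto
qed

locale embedded_graph =
  fixes V :: "'v set" and Ed :: "'e set" and ends :: "'e \<Rightarrow> 'v \<times> 'v"
    and p :: "'v \<Rightarrow> real^2" and c :: "'e \<Rightarrow> real \<Rightarrow> real^2"
  assumes loopless: "loopless_graph V Ed ends" and embedding: "planar_embedding V Ed ends p c"
begin

lemma finite_graph: "finite V" "finite Ed"
  using loopless by (auto simp: loopless_graph_def finite_graph_def)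

lemma inj_on_vertices: "inj_on p V"
  using embedding by (simp add: planar_embedding_def)

lemma
  assumes "e \<in> Ed"
  shows ends_mem: "fst (ends e) \<in> V" "snd (ends e) \<in> V"
    and arc: "arc (c e)"
    and arc_ends: "c e 0 = p (fst (ends e))" "c e 1 = p (snd (ends e))"
    and arc_meets_vertices: "path_image (c e) \<inter> p ` V \<subseteq> {p (fst (ends e)), p (snd (ends e))}"
  using loopless embedding assms
  unfolding loopless_graph_def finite_graph_def planar_embedding_def
    pathstart_def pathfinish_def case_prod_unfold
  by metis+

lemma continuous_on_arc: "e \<in> Ed \<Longrightarrow> continuous_on {0..1} (c e)"
  using arc by (simp add: arc_def path_def)

lemma arc_interior_not_vertex:
  assumes "e \<in> Ed" "0 < x" "x < 1"
  shows "c e x \<notin> p ` V"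
proof
  assume "c e x \<in> p ` V"
  moreover have "c e x \<in> path_image (c e)" using assms by (auto simp: path_image_def)
  ultimately have "c e x = c e 0 \<or> c e x = c e 1"
    using arc_meets_vertices[OF assms(1)] arc_ends[OF assms(1)] by auto
  moreover have "inj_on (c e) {0..1}" using arc[OF assms(1)] by (simp add: arc_def)
  ultimately show False using assms by (auto dest: inj_onD)
qed

lemma vertices_separated: "\<exists>\<delta>>0. \<forall>u\<in>V. \<forall>v\<in>V. u \<noteq> v \<longrightarrow> \<delta> \<le> dist (p u) (p v)"
proof -
  have "\<exists>\<delta>>0. \<forall>(u, v)\<in>{(u, v) \<in> V \<times> V. u \<noteq> v}. \<forall>x\<in>{p u}. \<forall>y\<in>{p v}. \<delta> \<le> dist x y"
    unfolding case_prod_unfold using finite_graph(1) inj_on_vertices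
    by (intro finite_family_separated) (auto simp: inj_on_def intro: finite_subset[of _ "V \<times> V"])
  then show ?thesis by auto
qed

lemma arcs_separated_from_vertices:
  "\<exists>\<delta>>0. \<forall>e\<in>Ed. \<forall>v\<in>V. v \<noteq> fst (ends e) \<longrightarrow> v \<noteq> snd (ends e) \<longrightarrow> (\<forall>z\<in>path_image (c e). \<delta> \<le> dist z (p v))"
proof -
  let ?I = "{(e, v) \<in> Ed \<times> V. v \<noteq> fst (ends e) \<and> v \<noteq> snd (ends e)}"
  have "\<exists>\<delta>>0. \<forall>i\<in>?I. \<forall>z\<in>path_image (c (fst i)). \<forall>y\<in>{p (snd i)}. \<delta> \<le> dist z y"
  proof (rule finite_family_separated)
    show "finite ?I" using finite_graph by (auto intro: finite_subset[of _ "Ed \<times> V"])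
    fix i assume "i \<in> ?I"
    then obtain e v where i: "i = (e, v)" "e \<in> Ed" "v \<in> V" "v \<noteq> fst (ends e)" "v \<noteq> snd (ends e)" by auto
    have "p v \<notin> path_image (c e)"
      using arc_meets_vertices[OF i(2)] ends_mem[OF i(2)] i inj_on_vertices by (auto simp: inj_on_def)
    then show "compact (path_image (c (fst i))) \<and> closed {p (snd i)} \<and>
        path_image (c (fst i)) \<inter> {p (snd i)} = {}"
      using arc[OF i(2)] i(1) by (auto intro: compact_path_image arc_imp_path)
  qed
  then show ?thesis by auto
qed

lemma trimmed_arcs_separated:
  assumes trim: "\<forall>e\<in>Ed. 0 < s e \<and> t e < 1"
  shows "\<exists>\<delta>>0. \<forall>e\<in>Ed. \<forall>f\<in>Ed. e \<noteq> f \<longrightarrow> (\<forall>x\<in>{s e..t e}. \<forall>y\<in>{s f..t f}. \<delta> \<le> dist (c e x) (c f y))"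
proof -
  let ?I = "{(e, f) \<in> Ed \<times> Ed. e \<noteq> f}" and ?C = "\<lambda>e. c e ` {s e..t e}"
  have "\<exists>\<delta>>0. \<forall>i\<in>?I. \<forall>z\<in>?C (fst i). \<forall>z'\<in>?C (snd i). \<delta> \<le> dist z z'"
  proof (rule finite_family_separated)
    show "finite ?I" using finite_graph by (auto intro: finite_subset[of _ "Ed \<times> Ed"])
    fix i assume "i \<in> ?I"
    then obtain e f where i: "i = (e, f)" "e \<in> Ed" "f \<in> Ed" "e \<noteq> f" by auto
    have compact: "compact (?C e)" if "e \<in> Ed" for e
      using trim that
      by (intro compact_continuous_image continuous_on_subset[OF continuous_on_arc[OF that]]) auto
    have image: "?C e \<subseteq> path_image (c e)" if "e \<in> Ed" for e
      using trim that unfolding path_image_def by (intro image_mono) auto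
    have "path_image (c e) \<inter> path_image (c f) \<subseteq> p ` V"
      using embedding i by (auto simp: planar_embedding_def)
    moreover have "c e x \<notin> p ` V" if "x \<in> {s e..t e}" for x
      using that trim i(2) by (intro arc_interior_not_vertex) auto
    ultimately have "?C e \<inter> ?C f = {}" using image i(2,3) by blast
    then show "compact (?C (fst i)) \<and> closed (?C (snd i)) \<and> ?C (fst i) \<inter> ?C (snd i) = {}"
      using compact i by (simp add: compact_imp_closed)
  qed
  then show ?thesis by auto
qed

lemma ex_trimmed_arcs:
  assumes "0 < \<rho>"
  shows "\<exists>s t. \<forall>e\<in>Ed. 0 < s e \<and> s e < t e \<and> t e < 1 \<and>
    dist (p (fst (ends e))) (c e (s e)) < \<rho> \<and> dist (p (snd (ends e))) (c e (t e)) < \<rho>"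
proof -
  have "\<forall>e\<in>Ed. \<exists>s t. 0 < s \<and> s < t \<and> t < 1 \<and>
      dist (p (fst (ends e))) (c e s) < \<rho> \<and> dist (p (snd (ends e))) (c e t) < \<rho>"
    using path_trim[OF continuous_on_arc assms] arc_ends by metis
  then show ?thesis by (simp only: bchoice_iff)
qed

lemma ex_grid_minor: "\<exists>B g. minor_model V Ed ends (grid_edges UNIV) B g \<and> (\<forall>v\<in>V. finite (B v))"
proof -
  obtain \<delta>1 where \<delta>1: "\<delta>1 > 0" "\<forall>u\<in>V. \<forall>v\<in>V. u \<noteq> v \<longrightarrow> \<delta>1 \<le> dist (p u) (p v)"
    using vertices_separated by blast
  obtain \<delta>2 where \<delta>2: "\<delta>2 > 0" "\<forall>e\<in>Ed. \<forall>v\<in>V. v \<noteq> fst (ends e) \<longrightarrow> v \<noteq> snd (ends e) \<longrightarrow>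
      (\<forall>z\<in>path_image (c e). \<delta>2 \<le> dist z (p v))"
    using arcs_separated_from_vertices by blast
  define \<rho> where "\<rho> = min \<delta>1 \<delta>2 / 10"
  have \<rho>: "\<rho> > 0" "10 * \<rho> \<le> \<delta>1" "10 * \<rho> \<le> \<delta>2" using \<delta>1(1) \<delta>2(1) by (auto simp: \<rho>_def)
  obtain s t where trim: "\<forall>e\<in>Ed. 0 < s e \<and> s e < t e \<and> t e < 1 \<and>
      dist (p (fst (ends e))) (c e (s e)) < \<rho> \<and> dist (p (snd (ends e))) (c e (t e)) < \<rho>"
    using ex_trimmed_arcs[OF \<rho>(1)] by blast
  then have "\<forall>e\<in>Ed. 0 < s e \<and> t e < 1" by blast
  from trimmed_arcs_separated[OF this] obtain \<delta>3 where \<delta>3: "\<delta>3 > 0"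
    "\<forall>e\<in>Ed. \<forall>f\<in>Ed. e \<noteq> f \<longrightarrow> (\<forall>x\<in>{s e..t e}. \<forall>y\<in>{s f..t f}. \<delta>3 \<le> dist (c e x) (c f y))"
    by (elim exE conjE)
  show ?thesis
  proof (rule grid_minor_of_separated_arcs[OF loopless \<rho>(1) \<delta>3(1), where p = p and \<gamma> = c])
    show "10 * \<rho> \<le> dist (p u) (p v)" if "u \<in> V" "v \<in> V" "u \<noteq> v" for u v
      using \<delta>1(2) \<rho>(2) that by fastforce
    show "10 * \<rho> \<le> dist (c e x) (p v)"
      if "e \<in> Ed" "v \<in> V" "v \<noteq> fst (ends e)" "v \<noteq> snd (ends e)" "x \<in> {s e..t e}" for e v x
    proof -
      have "c e x \<in> path_image (c e)" using trim that by (auto simp: path_image_def)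
      then have "\<delta>2 \<le> dist (c e x) (p v)" using \<delta>2(2) that by blast
      then show ?thesis using \<rho>(3) by linarith
    qed
    show "\<delta>3 \<le> dist (c e x) (c f y)"
      if "e \<in> Ed" "f \<in> Ed" "e \<noteq> f" "x \<in> {s e..t e}" "y \<in> {s f..t f}" for e f x y
      using \<delta>3(2) that by blast
    show "continuous_on {s e..t e} (c e)" if "e \<in> Ed" for e
      using trim that by (intro continuous_on_subset[OF continuous_on_arc[OF that]]) auto
  qed (use trim in \<open>auto intro: less_imp_le\<close>)
qed

end

lemma finite_subset_forward_closed:
  assumes "finite S"
  shows "\<exists>U. finite U \<and> forward_closed U \<and> S \<subseteq> U"
proof -
  define n where "n = Max (insert 0 ((\<lambda>(i, j). max \<bar>i\<bar> \<bar>j\<bar>) ` S))"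
  define U where "U = insert (n + 1, n) ({-n..n} \<times> {-n..n})"
  have "(\<lambda>(i, j). max \<bar>i\<bar> \<bar>j\<bar>) q \<le> n" if "q \<in> S" for q
    unfolding n_def using assms that by (intro Max_ge) auto
  then have "S \<subseteq> U" by (fastforce simp: U_def)
  moreover have "n \<ge> 0" unfolding n_def using assms by (intro Max_ge) auto
  then have "forward_closed U" by (auto simp: forward_closed_def U_def)
  moreover have "finite U" by (simp add: U_def)
  ultimately show ?thesis by blast
qed

lemma minor_model_restrict_grid:
  assumes "loopless_graph V Ed ends" "minor_model V Ed ends (grid_edges UNIV) B g"
    "\<And>v. v \<in> V \<Longrightarrow> B v \<subseteq> U"
  shows "minor_model V Ed ends (grid_edges U) B g"
proof -
  have restrict: "(p, q) \<in> grid_edges U \<longleftrightarrow> (p, q) \<in> grid_edges UNIV \<and> p \<in> U \<and> q \<in> U" for p q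
    by (auto simp: grid_edges_def)
  have "linked (grid_edges U) (B v) = linked (grid_edges UNIV) (B v)" if "v \<in> V" for v
    using assms(3)[OF that] by (auto simp: linked_def restrict)
  then have "connected_in (grid_edges U) (B v)" if "v \<in> V" for v
    using assms(2) that by (simp add: minor_model_def connected_in_def)
  moreover have "g e \<in> grid_edges U" if "e \<in> Ed" for e
  proof -
    have "B (fst (ends e)) \<subseteq> U" "B (snd (ends e)) \<subseteq> U"
      using assms(1,3) that by (simp_all add: loopless_graph_def finite_graph_def)
    moreover have "g e \<in> grid_edges UNIV"
      "g e \<in> B (fst (ends e)) \<times> B (snd (ends e)) \<union> B (snd (ends e)) \<times> B (fst (ends e))"
      using assms(2) that by (simp_all add: minor_model_def)
    ultimately show ?thesis by (cases "g e") (auto simp: restrict)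
  qed
  ultimately show ?thesis using assms(2) by (simp add: minor_model_def)
qed

lemma planar_graph_subset:
  assumes "planar_graph V Ed ends" "Ed' \<subseteq> Ed"
  shows "planar_graph V Ed' ends"
proof -
  obtain p c where "planar_embedding V Ed ends p c" using assms(1) by (auto simp: planar_graph_def)
  then have "planar_embedding V Ed' ends p c"
    unfolding planar_embedding_def using assms(2) by (meson subsetD)
  then show ?thesis by (auto simp: planar_graph_def)
qed

lemma scaffold0_remove_loops:
  assumes "finite Ed" and m: "\<And>e x. e \<in> Ed \<Longrightarrow> fst (ends e) = snd (ends e) \<Longrightarrow> w e x x = m e"
  shows "scaffold0 V Ed ends w = (\<Prod>e | e \<in> Ed \<and> fst (ends e) = snd (ends e). m e) *
    scaffold0 V {e \<in> Ed. fst (ends e) \<noteq> snd (ends e)} ends w"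
proof -
  let ?L = "{e \<in> Ed. fst (ends e) = snd (ends e)}" and ?N = "{e \<in> Ed. fst (ends e) \<noteq> snd (ends e)}"
  have "(\<Prod>e\<in>Ed. w e (\<phi> (fst (ends e))) (\<phi> (snd (ends e)))) =
      prod m ?L * (\<Prod>e\<in>?N. w e (\<phi> (fst (ends e))) (\<phi> (snd (ends e))))" for \<phi>
  proof -
    have "(\<Prod>e\<in>?L. w e (\<phi> (fst (ends e))) (\<phi> (snd (ends e)))) = prod m ?L"
      using m by (intro prod.cong) auto
    moreover have "Ed = ?L \<union> ?N" "?L \<inter> ?N = {}" by blast+
    ultimately show ?thesis using assms(1) by (metis (no_types, lifting) finite_Un prod.union_disjoint)
  qed
  then show ?thesis by (simp add: scaffold0_def sum_distrib_left)
qed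

context star_triangle_pair
begin

lemma scaffold0_eq_of_loopless_planar:
  assumes loopless: "loopless_graph V Ed ends" and planar: "planar_graph V Ed ends"
    and w: "\<And>e. e \<in> Ed \<Longrightarrow> (w e, w' e) \<in> \<A>"
  shows "scaffold0 V Ed ends w = scaffold0 V Ed ends w'"
proof -
  obtain p c where "planar_embedding V Ed ends p c" using planar by (auto simp: planar_graph_def)
  then interpret embedded_graph V Ed ends p c using loopless by unfold_locales
  obtain B g where model: "minor_model V Ed ends (grid_edges UNIV) B g"
    and B: "\<And>v. v \<in> V \<Longrightarrow> finite (B v)"
    using ex_grid_minor by blast
  obtain U where U: "finite U" "forward_closed U" "\<Union>(B ` V) \<subseteq> U"
    using finite_subset_forward_closed[of "\<Union>(B ` V)"] finite_graph(1) B by blast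
  have "B v \<subseteq> U" if "v \<in> V" for v using U(3) that by blast
  then have "graph_minor V Ed ends U (grid_edges U) B g"
    using loopless U(1) minor_model_restrict_grid[OF loopless model, of U] by unfold_locales auto
  then show ?thesis
    using transfers_grid[OF U(1,2)] w by (rule scaffold0_eq_of_minor)
qed

theorem scaffold0_eq_of_planar:
  assumes graph: "finite_graph V Ed ends" and planar: "planar_graph V Ed ends"
    and w: "\<And>e. e \<in> Ed \<Longrightarrow> (w e, w' e) \<in> \<A>"
  shows "scaffold0 V Ed ends w = scaffold0 V Ed ends w'"
proof -
  let ?N = "{e \<in> Ed. fst (ends e) \<noteq> snd (ends e)}"
  have "\<forall>e\<in>Ed. \<exists>m. (\<forall>x. w e x x = m) \<and> (\<forall>x. w' e x x = m)" using diagonal w by blast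
  then obtain m where m: "\<And>e x. e \<in> Ed \<Longrightarrow> w e x x = m e" "\<And>e x. e \<in> Ed \<Longrightarrow> w' e x x = m e"
    by metis
  have "loopless_graph V ?N ends" using graph by (simp add: loopless_graph_def finite_graph_def)
  moreover have "planar_graph V ?N ends" using planar by (rule planar_graph_subset) blast
  ultimately have "scaffold0 V ?N ends w = scaffold0 V ?N ends w'"
    using w by (intro scaffold0_eq_of_loopless_planar) auto
  moreover have "finite Ed" using graph by (simp add: finite_graph_def)
  ultimately show ?thesis
    using m by (simp add: scaffold0_remove_loops[of Ed ends _ m])
qed

end

section \<open>Bose-Mesner algebras\<close>

definition lincomb :: "nat \<Rightarrow> (nat \<Rightarrow> complex) \<Rightarrow> (nat \<Rightarrow> 'x mat) \<Rightarrow> 'x mat" where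
  "lincomb d a F = (\<lambda>x y. \<Sum>i\<le>d. a i * F i x y)"

abbreviation triples :: "nat \<Rightarrow> (nat \<times> nat \<times> nat) set" where
  "triples d \<equiv> {..d} \<times> {..d} \<times> {..d}"

definition Upsilon_family :: "(nat \<Rightarrow> ('x::finite) mat) \<Rightarrow> nat \<times> nat \<times> nat \<Rightarrow> 'x \<times> 'x \<times> 'x \<Rightarrow> complex" where
  "Upsilon_family F = (\<lambda>(r, s, t). Upsilon (F r) (F s) (F t))"

definition Delta_family :: "(nat \<Rightarrow> 'x mat) \<Rightarrow> nat \<times> nat \<times> nat \<Rightarrow> 'x \<times> 'x \<times> 'x \<Rightarrow> complex" where
  "Delta_family F = (\<lambda>(r, s, t). Delta (F r) (F s) (F t))"

definition coeff3 ::
    "(nat \<Rightarrow> complex) \<Rightarrow> (nat \<Rightarrow> complex) \<Rightarrow> (nat \<Rightarrow> complex) \<Rightarrow> nat \<times> nat \<times> nat \<Rightarrow> complex" where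
  "coeff3 a b c = (\<lambda>(r, s, t). a r * b s * c t)"

lemma lincomb_cong: "(\<And>i. i \<le> d \<Longrightarrow> a i = b i) \<Longrightarrow> lincomb d a F = lincomb d b F"
  by (simp add: lincomb_def)

lemma lincomb_single: "r \<le> d \<Longrightarrow> lincomb d (\<lambda>i. of_bool (i = r)) F = F r"
  by (simp add: lincomb_def fun_eq_iff)

lemma lincomb_scale: "(\<lambda>x y. c * lincomb d a F x y) = lincomb d (\<lambda>i. c * a i) F"
  by (simp add: lincomb_def sum_distrib_left mult.assoc)

lemma lincomb_lincomb:
  assumes "\<forall>i\<le>d. F i = lincomb d (a i) G"
  shows "lincomb d c F = lincomb d (\<lambda>r. \<Sum>i\<le>d. c i * a i r) G"
proof (intro ext)
  fix x y
  have "lincomb d c F x y = (\<Sum>i\<le>d. \<Sum>r\<le>d. c i * a i r * G r x y)"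
    using assms by (simp add: lincomb_def sum_distrib_left mult.assoc)
  also have "\<dots> = (\<Sum>r\<le>d. \<Sum>i\<le>d. c i * a i r * G r x y)" by (rule sum.swap)
  finally show "lincomb d c F x y = lincomb d (\<lambda>r. \<Sum>i\<le>d. c i * a i r) G x y"
    by (simp add: lincomb_def sum_distrib_right)
qed

lemma ex_lincomb_iff_cspan:
  "(\<exists>c. M = lincomb d c F) \<longleftrightarrow> case_prod M \<in> cspan ((\<lambda>i. case_prod (F i)) ` {..d})"
  by (simp add: cspan_image lincomb_def fun_eq_iff)

lemma mmult_lincomb:
  "mmult (lincomb d a F) (lincomb d b G) = (\<lambda>x z. \<Sum>i\<le>d. \<Sum>j\<le>d. a i * b j * mmult (F i) (G j) x z)"
proof (intro ext)
  fix x z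
  have "mmult (lincomb d a F) (lincomb d b G) x z =
      (\<Sum>y\<in>UNIV. \<Sum>i\<le>d. \<Sum>j\<le>d. a i * b j * (F i x y * G j y z))"
    by (simp add: mmult_def lincomb_def sum_product mult_ac)
  also have "\<dots> = (\<Sum>i\<le>d. \<Sum>y\<in>UNIV. \<Sum>j\<le>d. a i * b j * (F i x y * G j y z))" by (rule sum.swap)
  also have "\<dots> = (\<Sum>i\<le>d. \<Sum>j\<le>d. \<Sum>y\<in>UNIV. a i * b j * (F i x y * G j y z))"
    by (intro sum.cong refl sum.swap)
  finally show "mmult (lincomb d a F) (lincomb d b G) x z =
      (\<Sum>i\<le>d. \<Sum>j\<le>d. a i * b j * mmult (F i) (G j) x z)"
    by (simp add: mmult_def sum_distrib_left)
qed

lemma sum_product3: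
  fixes f :: "'a \<Rightarrow> complex"
  shows "(\<Sum>i\<in>A. f i) * (\<Sum>j\<in>B. g j) * (\<Sum>k\<in>C. h k) = (\<Sum>(i, j, k)\<in>A \<times> B \<times> C. f i * g j * h k)"
proof -
  have "(\<Sum>(i, j, k)\<in>A \<times> B \<times> C. f i * g j * h k) = (\<Sum>i\<in>A. \<Sum>j\<in>B. \<Sum>k\<in>C. f i * g j * h k)"
    by (simp add: sum.cartesian_product')
  then show ?thesis
    by (simp add: sum_distrib_left[symmetric] sum_distrib_right[symmetric])
qed

lemma Upsilon_lincomb:
  "Upsilon (lincomb d a F) (lincomb d b F) (lincomb d c F) =
    (\<lambda>p. \<Sum>k\<in>triples d. coeff3 a b c k * Upsilon_family F k p)"
proof (intro ext, clarify)
  fix x y z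
  have "Upsilon (lincomb d a F) (lincomb d b F) (lincomb d c F) (x, y, z) =
     (\<Sum>u\<in>UNIV. \<Sum>(i, j, k)\<in>triples d. (a i * F i x u) * (b j * F j y u) * (c k * F k z u))"
    unfolding Upsilon_def lincomb_def prod.case sum_product3 ..
  also have "\<dots> = (\<Sum>k\<in>triples d. coeff3 a b c k * Upsilon_family F k (x, y, z))"
    unfolding coeff3_def Upsilon_family_def Upsilon_def case_prod_unfold sum_distrib_left
    by (subst sum.swap) (simp add: mult_ac)
  finally show "Upsilon (lincomb d a F) (lincomb d b F) (lincomb d c F) (x, y, z) =
      (\<Sum>k\<in>triples d. coeff3 a b c k * Upsilon_family F k (x, y, z))" .
qed

lemma Delta_lincomb:
  "Delta (lincomb d a F) (lincomb d b F) (lincomb d c F) =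
    (\<lambda>p. \<Sum>k\<in>triples d. coeff3 a b c k * Delta_family F k p)"
proof (intro ext, clarify)
  fix x y z
  have "Delta (lincomb d a F) (lincomb d b F) (lincomb d c F) (x, y, z) =
     (\<Sum>(i, j, k)\<in>triples d. (a i * F i x z) * (b j * F j x y) * (c k * F k y z))"
    unfolding Delta_def lincomb_def prod.case sum_product3 ..
  also have "\<dots> = (\<Sum>k\<in>triples d. coeff3 a b c k * Delta_family F k (x, y, z))"
    unfolding coeff3_def Delta_family_def Delta_def case_prod_unfold by (simp add: mult_ac)
  finally show "Delta (lincomb d a F) (lincomb d b F) (lincomb d c F) (x, y, z) =
      (\<Sum>k\<in>triples d. coeff3 a b c k * Delta_family F k (x, y, z))" .
qed

lemma sum_Upsilon_mult_Upsilon: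
  assumes "\<And>x y. F x y = F y x" "\<And>x y. G x y = G y x" "\<And>x y. H x y = H y x"
  shows "(\<Sum>p\<in>UNIV. Upsilon F G H p * Upsilon F' G' H' p) =
    (\<Sum>u\<in>UNIV. \<Sum>v\<in>UNIV. mmult F F' u v * mmult G G' u v * mmult H H' u v)"
proof -
  let ?f = "\<lambda>u v (x, y, z). (F u x * F' x v) * (G u y * G' y v) * (H u z * H' z v)"
  have "(\<Sum>p\<in>UNIV. Upsilon F G H p * Upsilon F' G' H' p) =
      (\<Sum>p\<in>UNIV. \<Sum>u\<in>UNIV. \<Sum>v\<in>UNIV. ?f u v p)"
  proof (rule sum.cong[OF refl])
    fix p :: "'a \<times> 'a \<times> 'a"
    obtain x y z where p: "p = (x, y, z)" by (cases p)
    show "Upsilon F G H p * Upsilon F' G' H' p = (\<Sum>u\<in>UNIV. \<Sum>v\<in>UNIV. ?f u v p)"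
      unfolding p Upsilon_def prod.case sum_product assms(1)[of x] assms(2)[of y] assms(3)[of z]
      by (intro sum.cong refl) (simp only: mult_ac)
  qed
  also have "\<dots> = (\<Sum>u\<in>UNIV. \<Sum>v\<in>UNIV. \<Sum>p\<in>UNIV. ?f u v p)"
    by (subst sum.swap) (intro sum.cong refl sum.swap)
  also have "\<dots> = (\<Sum>u\<in>UNIV. \<Sum>v\<in>UNIV. mmult F F' u v * mmult G G' u v * mmult H H' u v)"
    unfolding mmult_def sum_product3 UNIV_Times_UNIV ..
  finally show ?thesis .
qed

lemma bose_mesner_iff_lincomb: "M \<in> bose_mesner d R \<longleftrightarrow> (\<exists>c. M = lincomb d c (adj_mat R))"
  by (simp add: bose_mesner_def lincomb_def)

locale assoc_scheme =
  fixes d :: nat and R :: "nat \<Rightarrow> ('x::finite \<times> 'x) set"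
  assumes scheme: "sym_assoc_scheme d R"
begin

definition rel :: "'x \<Rightarrow> 'x \<Rightarrow> nat" where
  "rel x y = (THE i. i \<le> d \<and> (x, y) \<in> R i)"

lemma rel_unique: "\<exists>!i. i \<le> d \<and> (x, y) \<in> R i"
  using scheme by (simp add: sym_assoc_scheme_def)

lemma rel_le: "rel x y \<le> d" and rel_mem: "(x, y) \<in> R (rel x y)"
  using theI'[OF rel_unique[of x y]] by (simp_all add: rel_def)

lemma rel_eq_iff: "i \<le> d \<Longrightarrow> (x, y) \<in> R i \<longleftrightarrow> rel x y = i"
  using rel_unique[of x y] rel_le rel_mem by blast

lemma rel_commute: "rel x y = rel y x"
  using rel_le rel_mem[of x y] scheme rel_eq_iff[of "rel x y" y x] by (simp add: sym_assoc_scheme_def)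

lemma rel_eq_0_iff: "rel x y = 0 \<longleftrightarrow> x = y"
  using rel_eq_iff[of 0 x y] scheme by (auto simp: sym_assoc_scheme_def)

lemma adj_mat_eq: "i \<le> d \<Longrightarrow> adj_mat R i x y = of_bool (rel x y = i)"
  by (simp add: adj_mat_def rel_eq_iff)

lemma lincomb_adj_mat: "lincomb d c (adj_mat R) = (\<lambda>x y. c (rel x y))"
proof (intro ext)
  fix x y
  have "lincomb d c (adj_mat R) x y = (\<Sum>i\<le>d. c i * of_bool (rel x y = i))"
    by (simp add: lincomb_def adj_mat_eq)
  then show "lincomb d c (adj_mat R) x y = c (rel x y)" using rel_le by simp
qed

lemma bose_mesner_iff: "M \<in> bose_mesner d R \<longleftrightarrow> (\<exists>c. M = (\<lambda>x y. c (rel x y)))"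
  by (simp add: bose_mesner_iff_lincomb lincomb_adj_mat)

lemma bose_mesner_add:
  "M \<in> bose_mesner d R \<Longrightarrow> N \<in> bose_mesner d R \<Longrightarrow> (\<lambda>x y. M x y + N x y) \<in> bose_mesner d R"
  unfolding bose_mesner_iff by (elim exE, rule exI[of _ "\<lambda>i. _ i + _ i"]) simp

lemma bose_mesner_scale: "M \<in> bose_mesner d R \<Longrightarrow> (\<lambda>x y. c * M x y) \<in> bose_mesner d R"
  unfolding bose_mesner_iff by (elim exE, rule exI[of _ "\<lambda>i. c * _ i"]) simp

lemma bose_mesner_schur: "M \<in> bose_mesner d R \<Longrightarrow> N \<in> bose_mesner d R \<Longrightarrow> schur M N \<in> bose_mesner d R"
  unfolding bose_mesner_iff by (elim exE, rule exI[of _ "\<lambda>i. _ i * _ i"]) (simp add: schur_def)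

lemma bose_mesner_cnj: "M \<in> bose_mesner d R \<Longrightarrow> (\<lambda>x y. cnj (M x y)) \<in> bose_mesner d R"
  unfolding bose_mesner_iff by (elim exE, rule exI[of _ "\<lambda>i. cnj (_ i)"]) simp

lemma adj_mat_mem: "i \<le> d \<Longrightarrow> adj_mat R i \<in> bose_mesner d R"
  unfolding bose_mesner_iff_lincomb by (metis lincomb_single)

lemma adj_mat_0: "adj_mat R 0 = id_mat"
  by (simp add: adj_mat_eq rel_eq_0_iff id_mat_def fun_eq_iff)

lemma lincomb_adj_mat_ones: "lincomb d (\<lambda>_. 1) (adj_mat R) = (\<lambda>_ _. 1)"
  by (simp add: lincomb_adj_mat)

abbreviation triangle :: "nat \<times> nat \<times> nat \<Rightarrow> 'x \<times> 'x \<times> 'x \<Rightarrow> complex" where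
  "triangle \<equiv> Delta_family (adj_mat R)"

lemma Delta_alg_eq: "Delta_alg d R = cspan (triangle ` triples d)"
proof
  show "Delta_alg d R \<subseteq> cspan (triangle ` triples d)"
    unfolding Delta_alg_def
  proof (intro cspan_minimal subsetI, clarify)
    fix L M N assume "L \<in> bose_mesner d R" "M \<in> bose_mesner d R" "N \<in> bose_mesner d R"
    then obtain a b c where LMN: "L = lincomb d a (adj_mat R)" "M = lincomb d b (adj_mat R)"
      "N = lincomb d c (adj_mat R)"
      by (auto simp: bose_mesner_iff_lincomb)
    show "Delta L M N \<in> cspan (triangle ` triples d)"
      unfolding LMN Delta_lincomb by (intro cspan_sum cspan_base imageI)
  qed
  show "cspan (triangle ` triples d) \<subseteq> Delta_alg d R"
    unfolding Delta_alg_def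
    by (intro cspan_minimal subsetI cspan_base) (auto simp: Delta_family_def intro: adj_mat_mem)
qed

end

locale idempotent_scheme = assoc_scheme d R
  for d and R :: "nat \<Rightarrow> ('x::finite \<times> 'x) set" +
  fixes E :: "nat \<Rightarrow> 'x mat"
  assumes idempotents: "prim_idempotents d R E"
begin

lemma E_mem: "r \<le> d \<Longrightarrow> E r \<in> bose_mesner d R"
  and E_commute: "r \<le> d \<Longrightarrow> E r x y = E r y x"
  and E_mmult: "r \<le> d \<Longrightarrow> s \<le> d \<Longrightarrow> mmult (E r) (E s) = (if r = s then E r else zero_mat)"
  and lincomb_E_ones: "lincomb d (\<lambda>_. 1) E = id_mat"
  and E_independent: "lincomb d c E = zero_mat \<Longrightarrow> r \<le> d \<Longrightarrow> c r = 0"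
  using idempotents by (auto simp: prim_idempotents_def lincomb_def)

lemma lincomb_E_unique:
  assumes "lincomb d a E = lincomb d b E" "r \<le> d"
  shows "a r = b r"
proof -
  have "lincomb d (\<lambda>i. a i - b i) E = zero_mat"
    using assms(1) by (auto simp: lincomb_def zero_mat_def fun_eq_iff left_diff_distrib sum_subtractf)
  from E_independent[OF this assms(2)] show ?thesis by simp
qed

lemma bose_mesner_lincomb_E:
  assumes "M \<in> bose_mesner d R"
  shows "\<exists>a. M = lincomb d a E"
proof -
  have "cspan ((\<lambda>i. case_prod (E i)) ` {..d}) = cspan ((\<lambda>i. case_prod (adj_mat R i)) ` {..d})"
  proof (rule cspan_independent_family)
    show "(\<lambda>i. case_prod (E i)) ` {..d} \<subseteq> cspan ((\<lambda>i. case_prod (adj_mat R i)) ` {..d})"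
      using E_mem by (auto simp: bose_mesner_iff_lincomb ex_lincomb_iff_cspan)
    show "c i = 0" if "(\<lambda>a. \<Sum>i\<le>d. c i * case_prod (E i) a) = (\<lambda>_. 0)" "i \<in> {..d}" for c i
      using that by (intro E_independent[of c]) (auto simp: lincomb_def zero_mat_def fun_eq_iff)
  qed simp
  then show ?thesis using assms by (simp add: bose_mesner_iff_lincomb ex_lincomb_iff_cspan)
qed

lemma mmult_lincomb_E: "mmult (lincomb d a E) (lincomb d b E) = lincomb d (\<lambda>r. a r * b r) E"
proof (intro ext)
  fix x z
  have "mmult (lincomb d a E) (lincomb d b E) x z =
      (\<Sum>i\<le>d. \<Sum>j\<le>d. if j = i then a i * b i * E i x z else 0)"
    unfolding mmult_lincomb by (intro sum.cong refl) (auto simp: E_mmult zero_mat_def)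
  then show "mmult (lincomb d a E) (lincomb d b E) x z = lincomb d (\<lambda>r. a r * b r) E x z"
    by (simp add: lincomb_def)
qed

lemma mmult_E_lincomb:
  assumes "r \<le> d"
  shows "mmult (E r) (lincomb d a E) = (\<lambda>x y. a r * E r x y)"
proof -
  have "mmult (E r) (lincomb d a E) = lincomb d (\<lambda>i. of_bool (i = r) * a i) E"
    unfolding mmult_lincomb_E[symmetric] by (simp add: lincomb_single assms)
  also have "\<dots> = lincomb d (\<lambda>i. a r * of_bool (i = r)) E" by (rule lincomb_cong) auto
  finally show ?thesis unfolding lincomb_scale[symmetric] by (simp add: lincomb_single assms)
qed

lemma E_nonzero:
  assumes "r \<le> d"
  shows "\<exists>x y. E r x y \<noteq> 0"
proof (rule ccontr)
  assume "\<not> ?thesis"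
  then have "lincomb d (\<lambda>i. of_bool (i = r)) E = zero_mat"
    using lincomb_single[OF assms, of E] by (auto simp: zero_mat_def)
  from E_independent[OF this assms] show False by simp
qed

lemma sum_norm_E_pos:
  assumes "r \<le> d"
  shows "(\<Sum>x\<in>UNIV. \<Sum>y\<in>UNIV. (cmod (E r x y))\<^sup>2) > 0"
proof -
  obtain x y where "E r x y \<noteq> 0" using E_nonzero[OF assms] by blast
  then have "0 < (\<Sum>y\<in>UNIV. (cmod (E r x y))\<^sup>2)" by (intro sum_pos2[of _ y]) auto
  then show ?thesis by (rule sum_pos2[of _ x, rotated 2]) (auto intro: sum_nonneg)
qed

text \<open>The conjugate \<open>C\<close> of \<open>E\<^sub>r\<close> is an idempotent of the algebra, so \<open>E\<^sub>r C\<close> is \<open>0\<close> or \<open>E\<^sub>r\<close>. Its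
  diagonal entries are the square norms of the rows of \<open>E\<^sub>r\<close>, so it is \<open>E\<^sub>r\<close>,
  and conjugation gives \<open>C = E\<^sub>r\<close>.\<close>

lemma E_cnj:
  assumes r: "r \<le> d"
  shows "cnj (E r x y) = E r x y"
proof -
  define C where "C = (\<lambda>x y. cnj (E r x y))"
  have cnj_mmult: "mmult (\<lambda>x y. cnj (L x y)) (\<lambda>x y. cnj (M x y)) = (\<lambda>x y. cnj (mmult L M x y))"
    for L M :: "'x mat"
    by (simp add: mmult_def)
  obtain a where a: "C = lincomb d a E"
    using bose_mesner_lincomb_E[OF bose_mesner_cnj[OF E_mem[OF r]]] by (auto simp: C_def)
  have E_C: "mmult (E r) C = (\<lambda>x y. a r * E r x y)" unfolding a by (rule mmult_E_lincomb[OF r])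
  have "mmult C C = C" using cnj_mmult[of "E r" "E r"] by (simp add: C_def E_mmult r)
  then have "a r * a r = a r" unfolding a mmult_lincomb_E using r by (rule lincomb_E_unique)
  moreover have "a r \<noteq> 0"
  proof
    assume "a r = 0"
    define n where "n = (\<Sum>x\<in>UNIV. \<Sum>y\<in>UNIV. (cmod (E r x y))\<^sup>2)"
    have "complex_of_real n = (\<Sum>x\<in>UNIV. mmult (E r) C x x)"
      unfolding n_def mmult_def C_def of_real_sum complex_norm_square
      by (intro sum.cong refl) (metis E_commute[OF r])
    also have "\<dots> = 0" by (simp add: E_C \<open>a r = 0\<close>)
    finally have "n = 0" by (simp only: of_real_eq_0_iff)
    then show False using sum_norm_E_pos[OF r] by (simp add: n_def)
  qed
  ultimately have "mmult (E r) C = E r" by (simp add: E_C)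
  moreover have "mmult C (E r) = C"
    using cnj_mmult[of "E r" C] \<open>mmult (E r) C = E r\<close> by (simp add: C_def)
  moreover have "mmult C (E r) = mmult (E r) C"
    using mmult_lincomb_E[of a "\<lambda>i. of_bool (i = r)"] mmult_lincomb_E[of "\<lambda>i. of_bool (i = r)" a]
    by (simp add: a lincomb_single[OF r] mult.commute)
  ultimately show ?thesis by (metis C_def)
qed

lemma sum_E_mult_E:
  assumes "r \<le> d" "s \<le> d" "r \<noteq> s"
  shows "(\<Sum>x\<in>UNIV. \<Sum>y\<in>UNIV. E r x y * E s x y) = 0"
proof -
  have "(\<Sum>x\<in>UNIV. \<Sum>y\<in>UNIV. E r x y * E s x y) = (\<Sum>x\<in>UNIV. mmult (E r) (E s) x x)"
    unfolding mmult_def using E_commute[OF assms(2)] by (intro sum.cong refl) metis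
  then show ?thesis using assms by (simp add: E_mmult zero_mat_def)
qed

lemma sum_E_square:
  assumes "r \<le> d"
  shows "(\<Sum>x\<in>UNIV. \<Sum>y\<in>UNIV. E r x y * E r x y) = complex_of_real (\<Sum>x\<in>UNIV. \<Sum>y\<in>UNIV. (cmod (E r x y))\<^sup>2)"
  by (simp only: of_real_sum complex_norm_square E_cnj[OF assms])

lemma column_sum_lincomb_E:
  assumes ones: "(\<lambda>_ _. 1) = lincomb d b E" and r: "r \<le> d" "b r \<noteq> 0"
  shows "(\<Sum>x\<in>UNIV. lincomb d a E x y) = a r"
proof -
  let ?J = "\<lambda>_ _. 1 :: complex" and ?M = "lincomb d a E"
  define m where "m = (\<Sum>x\<in>UNIV. ?M y x)"
  have J_M: "mmult ?J ?M = mmult ?M ?J" unfolding ones mmult_lincomb_E by (simp add: mult.commute)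
  have column: "(\<Sum>x\<in>UNIV. ?M x z) = m" for z
    using fun_cong[OF fun_cong[OF J_M], of y z] by (simp add: mmult_def m_def)
  have "lincomb d (\<lambda>r. b r * a r) E = mmult ?J ?M" unfolding ones mmult_lincomb_E ..
  also have "\<dots> = (\<lambda>x y. m * ?J x y)" using column by (simp add: mmult_def)
  also have "\<dots> = lincomb d (\<lambda>r. m * b r) E" unfolding lincomb_scale[symmetric] ones[symmetric] ..
  finally have "b r * a r = m * b r" using r(1) by (rule lincomb_E_unique)
  then show ?thesis using column r(2) by simp
qed

abbreviation star :: "nat \<times> nat \<times> nat \<Rightarrow> 'x \<times> 'x \<times> 'x \<Rightarrow> complex" where
  "star \<equiv> Upsilon_family E"

lemma Upsilon_alg_eq: "Upsilon_alg d R = cspan (star ` triples d)"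
proof
  show "Upsilon_alg d R \<subseteq> cspan (star ` triples d)"
    unfolding Upsilon_alg_def
  proof (intro cspan_minimal subsetI, clarify)
    fix L M N assume "L \<in> bose_mesner d R" "M \<in> bose_mesner d R" "N \<in> bose_mesner d R"
    then obtain a b c where LMN: "L = lincomb d a E" "M = lincomb d b E" "N = lincomb d c E"
      by (metis bose_mesner_lincomb_E)
    show "Upsilon L M N \<in> cspan (star ` triples d)"
      unfolding LMN Upsilon_lincomb by (intro cspan_sum cspan_base imageI)
  qed
  show "cspan (star ` triples d) \<subseteq> Upsilon_alg d R"
    unfolding Upsilon_alg_def
    by (intro cspan_minimal subsetI cspan_base) (auto simp: Upsilon_family_def intro: E_mem)
qed

lemma star_orthogonal:
  assumes "j \<in> triples d" "k \<in> triples d" "j \<noteq> k"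
  shows "(\<Sum>p\<in>UNIV. star j p * star k p) = 0"
proof -
  obtain r s t r' s' t' where jk: "j = (r, s, t)" "k = (r', s', t')" by (cases j, cases k)
  have "(\<Sum>p\<in>UNIV. star j p * star k p) =
      (\<Sum>u\<in>UNIV. \<Sum>v\<in>UNIV. mmult (E r) (E r') u v * mmult (E s) (E s') u v * mmult (E t) (E t') u v)"
    using assms E_commute unfolding jk Upsilon_family_def prod.case
    by (intro sum_Upsilon_mult_Upsilon) auto
  then show ?thesis using assms by (auto simp: jk E_mmult zero_mat_def)
qed

lemma sum_star_square:
  assumes "r \<le> d" "s \<le> d" "t \<le> d"
  shows "(\<Sum>p\<in>UNIV. star (r, s, t) p * star (r, s, t) p) =
    (\<Sum>u\<in>UNIV. \<Sum>v\<in>UNIV. schur (E r) (E s) u v * E t u v)"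
  using assms E_commute
  by (simp add: Upsilon_family_def sum_Upsilon_mult_Upsilon E_mmult schur_def)

lemma sum_star_square_eq_norm:
  assumes "k \<in> triples d"
  shows "(\<Sum>p\<in>UNIV. star k p * star k p) = complex_of_real (\<Sum>p\<in>UNIV. (cmod (star k p))\<^sup>2)"
proof -
  have "cnj (star k p) = star k p" for p
    using assms by (cases p) (auto simp: Upsilon_family_def Upsilon_def E_cnj)
  then show ?thesis by (simp only: of_real_sum complex_norm_square)
qed

lemma sum_norm_star_eq_0_iff: "(\<Sum>p\<in>UNIV. (cmod (star k p))\<^sup>2) = 0 \<longleftrightarrow> star k = (\<lambda>_. 0)"
  by (auto simp: sum_nonneg_eq_0_iff fun_eq_iff)

lemma star_coeff_unique:
  assumes eq: "(\<lambda>p. \<Sum>j\<in>triples d. a j * star j p) = (\<lambda>p. \<Sum>j\<in>triples d. b j * star j p)"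
    and k: "k \<in> triples d" and nonzero: "star k \<noteq> (\<lambda>_. 0)"
  shows "a k = b k"
proof -
  let ?q = "\<Sum>p\<in>UNIV. star k p * star k p"
  have contract: "(\<Sum>p\<in>UNIV. (\<Sum>j\<in>triples d. c j * star j p) * star k p) = c k * ?q" for c
  proof -
    have "(\<Sum>p\<in>UNIV. (\<Sum>j\<in>triples d. c j * star j p) * star k p) =
        (\<Sum>j\<in>triples d. c j * (\<Sum>p\<in>UNIV. star j p * star k p))"
      by (simp add: sum_distrib_left sum_distrib_right mult.assoc sum.swap[of _ "triples d"])
    also have "\<dots> = (\<Sum>j\<in>triples d. if j = k then c k * ?q else 0)"
      using star_orthogonal k by (intro sum.cong refl) auto
    finally show ?thesis using k by simp
  qed
  have "a k * ?q = b k * ?q" unfolding contract[symmetric] using fun_cong[OF eq] by simp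
  moreover have "?q \<noteq> 0"
    unfolding sum_star_square_eq_norm[OF k] of_real_eq_0_iff sum_norm_star_eq_0_iff by (rule nonzero)
  ultimately show ?thesis by simp
qed

lemma krein_eq:
  assumes "t \<le> d" and k: "schur (E r) (E s) = lincomb d k E"
  shows "krein d E r s t = of_nat CARD('x) * k t"
proof -
  define n where "n = complex_of_nat CARD('x)"
  have n: "n \<noteq> 0" by (simp add: n_def)
  have expansion: "(\<lambda>x y. 1 / n * (\<Sum>i\<le>d. q i * E i x y)) = lincomb d (\<lambda>i. q i / n) E" for q
    by (simp add: lincomb_def sum_divide_distrib)
  let ?q = "\<lambda>i. if i \<le> d then n * k i else 0"
  have "krein d E r s = ?q"
    unfolding krein_def n_def[symmetric] expansion k
  proof (rule ext, rule arg_cong[where f = "\<lambda>q. q _"], rule the_equality)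
    show "(\<forall>i>d. ?q i = 0) \<and> lincomb d k E = lincomb d (\<lambda>i. ?q i / n) E"
      using n by (auto intro: lincomb_cong)
    fix q assume "(\<forall>i>d. q i = 0) \<and> lincomb d k E = lincomb d (\<lambda>i. q i / n) E"
    then have "q i = ?q i" for i
      using n lincomb_E_unique[of k "\<lambda>i. q i / n" i] by (cases "i \<le> d") auto
    then show "q = ?q" by blast
  qed
  then show ?thesis using assms(1) by (simp add: n_def)
qed

lemma cpos_krein_iff:
  assumes rst: "r \<le> d" "s \<le> d" "t \<le> d"
  shows "cpos (krein d E r s t) \<longleftrightarrow> star (r, s, t) \<noteq> (\<lambda>_. 0)"
proof -
  obtain k where k: "schur (E r) (E s) = lincomb d k E"
    using bose_mesner_lincomb_E[OF bose_mesner_schur[OF E_mem E_mem]] rst by blast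
  define l where "l = (\<Sum>p\<in>UNIV. (cmod (star (r, s, t) p))\<^sup>2)"
  define m where "m = (\<Sum>x\<in>UNIV. \<Sum>y\<in>UNIV. (cmod (E t x y))\<^sup>2)"
  have m: "m > 0" unfolding m_def using rst(3) by (rule sum_norm_E_pos)
  have l: "l \<ge> 0" unfolding l_def by (intro sum_nonneg) simp
  have "complex_of_real l = (\<Sum>p\<in>UNIV. star (r, s, t) p * star (r, s, t) p)"
    unfolding l_def by (rule sum_star_square_eq_norm[symmetric]) (use rst in simp)
  also have "\<dots> = (\<Sum>u\<in>UNIV. \<Sum>v\<in>UNIV. lincomb d k E u v * E t u v)"
    unfolding sum_star_square[OF rst] k ..
  also have "\<dots> = (\<Sum>i\<le>d. k i * (\<Sum>u\<in>UNIV. \<Sum>v\<in>UNIV. E i u v * E t u v))"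
    by (simp add: lincomb_def sum_distrib_left sum_distrib_right mult.assoc sum.swap[of _ "{..d}"])
  also have "\<dots> = (\<Sum>i\<le>d. if i = t then k t * complex_of_real m else 0)"
    using rst(3) sum_E_mult_E sum_E_square by (intro sum.cong refl) (auto simp: m_def)
  also have "\<dots> = k t * complex_of_real m" using rst(3) by simp
  finally have "k t = complex_of_real (l / m)" using m by (simp add: field_simps)
  then have "krein d E r s t = complex_of_real (real CARD('x) * (l / m))"
    using krein_eq[OF rst(3) k] by simp
  then have "cpos (krein d E r s t) \<longleftrightarrow> l > 0"
    using m by (simp add: cpos_def zero_less_mult_iff zero_less_divide_iff)
  also have "\<dots> \<longleftrightarrow> star (r, s, t) \<noteq> (\<lambda>_. 0)"
    using l sum_norm_star_eq_0_iff[of "(r, s, t)"] by (auto simp: l_def)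
  finally show ?thesis .
qed

lemma star_expansion_unique:
  assumes "T \<in> cspan (star ` triples d)"
  shows "\<exists>!a. (\<forall>k. k \<notin> triples d \<or> star k = (\<lambda>_. 0) \<longrightarrow> a k = 0) \<and>
    T = (\<lambda>p. \<Sum>k\<in>triples d. a k * star k p)"
proof -
  obtain a where a: "T = (\<lambda>p. \<Sum>k\<in>triples d. a k * star k p)" using assms by (auto simp: cspan_image)
  define a' where "a' = (\<lambda>k. if k \<notin> triples d \<or> star k = (\<lambda>_. 0) then 0 else a k)"
  have "T = (\<lambda>p. \<Sum>k\<in>triples d. a' k * star k p)"
    unfolding a by (intro ext sum.cong refl) (auto simp: a'_def)
  then show ?thesis
  proof (intro ex1I[of _ a'] conjI ext)
    fix b k assume b: "(\<forall>k. k \<notin> triples d \<or> star k = (\<lambda>_. 0) \<longrightarrow> b k = 0) \<and>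
        T = (\<lambda>p. \<Sum>k\<in>triples d. b k * star k p)"
    show "b k = a' k"
    proof (cases "k \<notin> triples d \<or> star k = (\<lambda>_. 0)")
      case True
      then have "b k = 0" using b by blast
      then show ?thesis using True by (simp add: a'_def)
    next
      case False
      then show ?thesis
        using star_coeff_unique[of b a' k] b \<open>T = (\<lambda>p. \<Sum>k\<in>triples d. a' k * star k p)\<close> by blast
    qed
  qed (auto simp: a'_def)
qed

lemma ex_star_nonzero:
  assumes r: "r \<le> d"
  shows "\<exists>s\<le>d. \<exists>t\<le>d. star (r, s, t) \<noteq> (\<lambda>_. 0)"
proof (rule ccontr)
  assume "\<not> ?thesis"
  then have zero: "star (r, s, t) p = 0" if "s \<le> d" "t \<le> d" for s t p using that by auto
  have "Upsilon (E r) id_mat id_mat =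
      (\<lambda>p. \<Sum>k\<in>triples d. coeff3 (\<lambda>i. of_bool (i = r)) (\<lambda>_. 1) (\<lambda>_. 1) k * star k p)"
    unfolding Upsilon_lincomb[symmetric] lincomb_E_ones lincomb_single[OF r] ..
  also have "\<dots> = (\<lambda>_. 0)"
    using zero by (intro ext sum.neutral) (auto simp: coeff3_def)
  finally have "Upsilon (E r) id_mat id_mat (x, y, y) = 0" for x y by simp
  then have "E r x y = 0" for x y
    by (simp add: Upsilon_def id_mat_def if_distrib[of "\<lambda>c. _ * c"] cong: if_cong)
  then show False using E_nonzero[OF r] by blast
qed

end

locale etr_scheme = idempotent_scheme d R E
  for d and R :: "nat \<Rightarrow> ('x::finite \<times> 'x) set" and E +
  assumes etr: "exactly_triply_regular d R"
begin

lemma cspan_star_eq_cspan_triangle: "cspan (star ` triples d) = cspan (triangle ` triples d)"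
  using etr unfolding exactly_triply_regular_def Upsilon_alg_eq Delta_alg_eq by blast

definition sigma :: "nat \<times> nat \<times> nat \<Rightarrow> nat \<times> nat \<times> nat \<Rightarrow> complex" where
  "sigma = (\<lambda>(i, j, l) (r, s, t). dw_sigma d R E i j l r s t)"

lemma
  assumes q: "q \<in> triples d"
  shows triangle_eq_sum_sigma: "triangle q = (\<lambda>p. \<Sum>k\<in>triples d. sigma q k * star k p)"
    and sigma_eq_0: "k \<in> triples d \<Longrightarrow> star k = (\<lambda>_. 0) \<Longrightarrow> sigma q k = 0"
proof -
  define expands where "expands = (\<lambda>a. (\<forall>k. k \<notin> triples d \<or> star k = (\<lambda>_. 0) \<longrightarrow> a k = 0) \<and>
      triangle q = (\<lambda>p. \<Sum>k\<in>triples d. a k * star k p))"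
  obtain i j l where ijl: "q = (i, j, l)" by (cases q)
  let ?Z = "{(r, s, t). r \<le> d \<and> s \<le> d \<and> t \<le> d \<and> cpos (krein d E r s t)}"
  have Z: "?Z = {k \<in> triples d. star k \<noteq> (\<lambda>_. 0)}" by (auto simp: cpos_krein_iff)
  have "dw_sigma d R E i j l = (THE \<sigma>. expands (\<lambda>(r, s, t). \<sigma> r s t))"
  proof -
    have "(\<lambda>a. \<Sum>(r, s, t)\<in>?Z. \<sigma> r s t * Upsilon (E r) (E s) (E t) a) =
        (\<lambda>p. \<Sum>k\<in>triples d. (case k of (r, s, t) \<Rightarrow> \<sigma> r s t) * star k p)" for \<sigma>
      unfolding Z by (intro ext sum.mono_neutral_cong_left) (auto simp: Upsilon_family_def)
    then show ?thesis
      unfolding dw_sigma_def expands_def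
      by (simp add: ijl Delta_family_def cpos_krein_iff cong: conj_cong) (metis)
  qed
  moreover have "\<exists>!\<sigma>. expands (\<lambda>(r, s, t). \<sigma> r s t)"
  proof -
    have "triangle q \<in> cspan (star ` triples d)"
      unfolding cspan_star_eq_cspan_triangle using q by (intro cspan_base imageI)
    then have "\<exists>!a. expands a" unfolding expands_def by (rule star_expansion_unique)
    then obtain a where "expands a" and unique: "\<And>b. expands b \<Longrightarrow> b = a" by (elim ex1E) blast
    show ?thesis
    proof (rule ex1I[of _ "\<lambda>r s t. a (r, s, t)"])
      show "expands (\<lambda>(r, s, t). a (r, s, t))" using \<open>expands a\<close> by simp
      show "\<sigma> = (\<lambda>r s t. a (r, s, t))" if "expands (\<lambda>(r, s, t). \<sigma> r s t)" for \<sigma>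
        using unique[OF that] by auto
    qed
  qed
  then have "expands (\<lambda>(r, s, t). (THE \<sigma>. expands (\<lambda>(r, s, t). \<sigma> r s t)) r s t)" by (rule theI')
  ultimately have "expands (\<lambda>(r, s, t). dw_sigma d R E i j l r s t)" by simp
  then have "expands (sigma q)" by (simp add: sigma_def ijl)
  then show "triangle q = (\<lambda>p. \<Sum>k\<in>triples d. sigma q k * star k p)"
    "k \<in> triples d \<Longrightarrow> star k = (\<lambda>_. 0) \<Longrightarrow> sigma q k = 0"
    unfolding expands_def by blast+
qed

text \<open>The star of three identity matrices is the diagonal triangle, so the Delta-Wye parameters
  determine which Krein parameters vanish.\<close>

lemma star_nonzero_iff_sigma:
  assumes "k \<in> triples d"
  shows "star k \<noteq> (\<lambda>_. 0) \<longleftrightarrow> sigma (0, 0, 0) k = 1"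
proof -
  have "Upsilon (id_mat :: 'x mat) id_mat id_mat = Delta id_mat id_mat id_mat"
    by (auto simp: Upsilon_def Delta_def id_mat_def fun_eq_iff if_distrib[of "\<lambda>c. c * _"] cong: if_cong)
  then have "(\<lambda>p. \<Sum>k\<in>triples d. coeff3 (\<lambda>_. 1) (\<lambda>_. 1) (\<lambda>_. 1) k * star k p) =
      (\<lambda>p. \<Sum>k\<in>triples d. sigma (0, 0, 0) k * star k p)"
    unfolding Upsilon_lincomb[symmetric] lincomb_E_ones
    using triangle_eq_sum_sigma[of "(0, 0, 0)"] by (simp add: Delta_family_def adj_mat_0)
  from star_coeff_unique[OF this assms] sigma_eq_0[of "(0, 0, 0)" k] assms show ?thesis
    by (auto simp: coeff3_def split: prod.splits)
qed

text \<open>Similarly \<open>\<Upsilon>(A\<^sub>i, I, I) = \<Sum>\<^sub>j \<Delta>(A\<^sub>j, A\<^sub>i, I)\<close> recovers the eigenvalues of \<open>A\<^sub>i\<close>.\<close>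

lemma eigenvalue_eq_sum_sigma:
  assumes i: "i \<le> d" "adj_mat R i = lincomb d a E" and rst: "(r, s, t) \<in> triples d"
    "star (r, s, t) \<noteq> (\<lambda>_. 0)"
  shows "a r = (\<Sum>j\<le>d. sigma (j, i, 0) (r, s, t))"
proof -
  have "Upsilon (adj_mat R i) id_mat id_mat = Delta (\<lambda>_ _. 1) (adj_mat R i) id_mat"
    by (auto simp: Upsilon_def Delta_def id_mat_def fun_eq_iff if_distrib[of "\<lambda>c. _ * c"] cong: if_cong)
  also have "\<dots> = (\<lambda>p. \<Sum>j\<le>d. triangle (j, i, 0) p)"
    by (auto simp: Delta_def Delta_family_def adj_mat_0 fun_eq_iff
        lincomb_adj_mat_ones[symmetric] lincomb_def sum_distrib_right)
  also have "\<dots> = (\<lambda>p. \<Sum>k\<in>triples d. (\<Sum>j\<le>d. sigma (j, i, 0) k) * star k p)"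
    using i(1) by (simp add: triangle_eq_sum_sigma sum_distrib_right sum.swap[of _ "{..d}" "triples d"])
  finally have "(\<lambda>p. \<Sum>k\<in>triples d. coeff3 a (\<lambda>_. 1) (\<lambda>_. 1) k * star k p) =
      (\<lambda>p. \<Sum>k\<in>triples d. (\<Sum>j\<le>d. sigma (j, i, 0) k) * star k p)"
    unfolding Upsilon_lincomb[symmetric] lincomb_E_ones i(2)[symmetric] .
  from star_coeff_unique[OF this rst] show ?thesis by (simp add: coeff3_def)
qed

end

section \<open>Pairs of schemes with the same Delta-Wye parameters\<close>

lemma sum_mult_sum_swap:
  fixes s :: "'a \<Rightarrow> complex"
  shows "(\<Sum>q\<in>A. s q * (\<Sum>k\<in>B. t q k * h k)) = (\<Sum>k\<in>B. (\<Sum>q\<in>A. s q * t q k) * h k)"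
  by (simp add: sum_distrib_left sum_distrib_right mult.assoc sum.swap[of _ A B])

lemma case_sum_linear_combination:
  "case_sum (\<lambda>p. \<Sum>k\<in>K. c k * f k p) (\<lambda>p. \<Sum>k\<in>K. c k * f' k p) = (\<lambda>a. \<Sum>k\<in>K. c k * case_sum (f k) (f' k) a)"
  by (auto simp: fun_eq_iff split: sum.split)

locale dw_pair = X: etr_scheme d R E + Y: etr_scheme d S E'
  for d and R :: "nat \<Rightarrow> ('x::finite \<times> 'x) set" and E
    and S :: "nat \<Rightarrow> ('y::finite \<times> 'y) set" and E' +
  assumes same_sigma: "\<And>q k. q \<in> triples d \<Longrightarrow> k \<in> triples d \<Longrightarrow> X.sigma q k = Y.sigma q k"
begin

lemma star_nonzero_iff: "k \<in> triples d \<Longrightarrow> X.star k \<noteq> (\<lambda>_. 0) \<longleftrightarrow> Y.star k \<noteq> (\<lambda>_. 0)"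
  using X.star_nonzero_iff_sigma[of k] Y.star_nonzero_iff_sigma[of k] same_sigma[of "(0, 0, 0)" k]
  by simp

definition algebra_pairs :: "('x mat \<times> 'y mat) set" where
  "algebra_pairs = {(lincomb d c (adj_mat R), lincomb d c (adj_mat S)) | c. True}"

lemma adj_mat_pair_lincomb_E:
  assumes i: "i \<le> d"
  shows "\<exists>a. adj_mat R i = lincomb d a E \<and> adj_mat S i = lincomb d a E'"
proof -
  obtain a b where a: "adj_mat R i = lincomb d a E" and b: "adj_mat S i = lincomb d b E'"
    using X.bose_mesner_lincomb_E[OF X.adj_mat_mem[OF i]] Y.bose_mesner_lincomb_E[OF Y.adj_mat_mem[OF i]]
    by blast
  have "b r = a r" if r: "r \<le> d" for r
  proof -
    obtain s t where X_star: "(r, s, t) \<in> triples d" "X.star (r, s, t) \<noteq> (\<lambda>_. 0)"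
      using X.ex_star_nonzero[OF r] r by auto
    then have Y_star: "Y.star (r, s, t) \<noteq> (\<lambda>_. 0)" using star_nonzero_iff by blast
    have "b r = (\<Sum>j\<le>d. Y.sigma (j, i, 0) (r, s, t))"
      by (rule Y.eigenvalue_eq_sum_sigma[OF i b X_star(1) Y_star])
    also have "\<dots> = (\<Sum>j\<le>d. X.sigma (j, i, 0) (r, s, t))"
      using same_sigma X_star(1) i by (intro sum.cong) auto
    also have "\<dots> = a r" by (rule X.eigenvalue_eq_sum_sigma[OF i a X_star, symmetric])
    finally show ?thesis .
  qed
  then have "lincomb d b E' = lincomb d a E'" by (rule lincomb_cong)
  then show ?thesis using a b by auto
qed

lemma E_pair_lincomb_adj_mat:
  assumes r: "r \<le> d"
  shows "\<exists>c. E r = lincomb d c (adj_mat R) \<and> E' r = lincomb d c (adj_mat S)"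
proof -
  from adj_mat_pair_lincomb_E obtain p where p: "\<forall>i\<le>d. adj_mat R i = lincomb d (p i) E"
    "\<forall>i\<le>d. adj_mat S i = lincomb d (p i) E'" by metis
  obtain c where c: "E r = lincomb d c (adj_mat R)"
    using X.E_mem[OF r] by (auto simp: bose_mesner_iff_lincomb)
  let ?q = "\<lambda>s. \<Sum>i\<le>d. c i * p i s"
  have "lincomb d ?q E = lincomb d (\<lambda>s. of_bool (s = r)) E"
    using lincomb_lincomb[OF p(1), of c] c by (simp add: lincomb_single[OF r])
  then have "?q s = of_bool (s = r)" if "s \<le> d" for s using that by (rule X.lincomb_E_unique)
  then have "lincomb d ?q E' = lincomb d (\<lambda>s. of_bool (s = r)) E'" by (rule lincomb_cong)
  then have "E' r = lincomb d c (adj_mat S)"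
    using lincomb_lincomb[OF p(2), of c] by (simp add: lincomb_single[OF r])
  with c show ?thesis by blast
qed

lemma algebra_pairs_eq_E: "algebra_pairs = {(lincomb d a E, lincomb d a E') | a. True}"
proof -
  from adj_mat_pair_lincomb_E obtain p where p: "\<forall>i\<le>d. adj_mat R i = lincomb d (p i) E"
    "\<forall>i\<le>d. adj_mat S i = lincomb d (p i) E'" by metis
  from E_pair_lincomb_adj_mat obtain q where q: "\<forall>r\<le>d. E r = lincomb d (q r) (adj_mat R)"
    "\<forall>r\<le>d. E' r = lincomb d (q r) (adj_mat S)" by metis
  show ?thesis
    unfolding algebra_pairs_def using lincomb_lincomb[OF p(1)] lincomb_lincomb[OF p(2)]
      lincomb_lincomb[OF q(1)] lincomb_lincomb[OF q(2)] by (intro equalityI subsetI) blast+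
qed

lemma E_pair: "r \<le> d \<Longrightarrow> (E r, E' r) \<in> algebra_pairs"
  using E_pair_lincomb_adj_mat by (auto simp: algebra_pairs_def)

lemma adj_mat_pair: "i \<le> d \<Longrightarrow> (adj_mat R i, adj_mat S i) \<in> algebra_pairs"
  using adj_mat_pair_lincomb_E by (auto simp: algebra_pairs_eq_E)

lemma algebra_pairs_mmult:
  "(L, L') \<in> algebra_pairs \<Longrightarrow> (M, M') \<in> algebra_pairs \<Longrightarrow> (mmult L M, mmult L' M') \<in> algebra_pairs"
  unfolding algebra_pairs_eq_E by (auto simp: X.mmult_lincomb_E Y.mmult_lincomb_E)

lemma ones_pair: "(\<lambda>_ _. 1, \<lambda>_ _. 1) \<in> algebra_pairs"
  unfolding algebra_pairs_def using X.lincomb_adj_mat_ones Y.lincomb_adj_mat_ones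
  by (metis (mono_tags) mem_Collect_eq)

lemma id_pair: "(id_mat, id_mat) \<in> algebra_pairs"
  unfolding algebra_pairs_eq_E using X.lincomb_E_ones Y.lincomb_E_ones
  by (metis (mono_tags) mem_Collect_eq)

lemma algebra_pairs_column_sum:
  assumes "(M, M') \<in> algebra_pairs"
  shows "\<exists>m. (\<forall>y. (\<Sum>x\<in>UNIV. M x y) = m) \<and> (\<forall>y. (\<Sum>x\<in>UNIV. M' x y) = m)"
proof -
  obtain a where a: "M = lincomb d a E" "M' = lincomb d a E'"
    using assms by (auto simp: algebra_pairs_eq_E)
  obtain b where b: "(\<lambda>_ _. 1) = lincomb d b E" "(\<lambda>_ _. 1) = lincomb d b E'"
    using ones_pair by (auto simp: algebra_pairs_eq_E)
  have "\<exists>r\<le>d. b r \<noteq> 0"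
  proof (rule ccontr)
    assume "\<not> ?thesis"
    then have "lincomb d b E = (\<lambda>_ _. 0)" by (auto simp: lincomb_def)
    then show False using b(1) by (metis zero_neq_one)
  qed
  then obtain r where "r \<le> d" "b r \<noteq> 0" by blast
  then show ?thesis
    unfolding a using X.column_sum_lincomb_E[OF b(1)] Y.column_sum_lincomb_E[OF b(2)] by blast
qed

lemma star_combination_transfer:
  assumes "(\<lambda>p. \<Sum>k\<in>triples d. a k * X.star k p) = (\<lambda>p. \<Sum>k\<in>triples d. b k * X.star k p)"
  shows "(\<lambda>p. \<Sum>k\<in>triples d. a k * Y.star k p) = (\<lambda>p. \<Sum>k\<in>triples d. b k * Y.star k p)"
proof (intro ext sum.cong refl)
  fix p k assume k: "k \<in> triples d"
  show "a k * Y.star k p = b k * Y.star k p"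
  proof (cases "Y.star k = (\<lambda>_. 0)")
    case False
    then have "a k = b k" using X.star_coeff_unique[OF assms k] star_nonzero_iff[OF k] by blast
    then show ?thesis by simp
  qed simp
qed

abbreviation star_pair :: "nat \<times> nat \<times> nat \<Rightarrow> ('x \<times> 'x \<times> 'x) + ('y \<times> 'y \<times> 'y) \<Rightarrow> complex" where
  "star_pair k \<equiv> case_sum (X.star k) (Y.star k)"

abbreviation triangle_pair :: "nat \<times> nat \<times> nat \<Rightarrow> ('x \<times> 'x \<times> 'x) + ('y \<times> 'y \<times> 'y) \<Rightarrow> complex" where
  "triangle_pair q \<equiv> case_sum (X.triangle q) (Y.triangle q)"

lemma Y_triangle_eq_sum_sigma:
  "q \<in> triples d \<Longrightarrow> Y.triangle q = (\<lambda>p. \<Sum>k\<in>triples d. X.sigma q k * Y.star k p)"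
  by (simp add: Y.triangle_eq_sum_sigma same_sigma)

lemma triangle_pair_mem: "q \<in> triples d \<Longrightarrow> triangle_pair q \<in> cspan (star_pair ` triples d)"
  unfolding X.triangle_eq_sum_sigma Y_triangle_eq_sum_sigma case_sum_linear_combination
  by (intro cspan_sum cspan_base imageI)

lemma star_pair_mem:
  assumes k: "k \<in> triples d"
  shows "star_pair k \<in> cspan (triangle_pair ` triples d)"
proof -
  have "X.star k \<in> cspan (X.triangle ` triples d)"
    unfolding X.cspan_star_eq_cspan_triangle[symmetric] using k by (intro cspan_base imageI)
  then obtain \<tau> where \<tau>: "X.star k = (\<lambda>p. \<Sum>q\<in>triples d. \<tau> q * X.triangle q p)"
    by (auto simp: cspan_image)
  define \<mu> where "\<mu> = (\<lambda>l. \<Sum>q\<in>triples d. \<tau> q * X.sigma q l)"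
  have single: "f k = (\<lambda>p. \<Sum>l\<in>triples d. of_bool (l = k) * f l p)" for f :: "_ \<Rightarrow> 'a \<Rightarrow> complex"
    using k by (simp add: fun_eq_iff)
  have "(\<lambda>p. \<Sum>l\<in>triples d. \<mu> l * X.star l p) = X.star k"
    unfolding \<tau> \<mu>_def sum_mult_sum_swap[symmetric] by (simp add: X.triangle_eq_sum_sigma)
  then have "(\<lambda>p. \<Sum>l\<in>triples d. \<mu> l * Y.star l p) = Y.star k"
    unfolding single[of X.star] single[of Y.star] by (rule star_combination_transfer)
  then have "Y.star k = (\<lambda>p. \<Sum>q\<in>triples d. \<tau> q * Y.triangle q p)"
    unfolding \<mu>_def sum_mult_sum_swap[symmetric] by (simp add: Y_triangle_eq_sum_sigma)
  with \<tau> have "star_pair k = (\<lambda>a. \<Sum>q\<in>triples d. \<tau> q * triangle_pair q a)"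
    by (simp only: case_sum_linear_combination)
  then show ?thesis by (simp only:) (intro cspan_sum cspan_base imageI)
qed

lemma triangle_pairs_subset: "triangle_pairs algebra_pairs \<subseteq> cspan (triangle_pair ` triples d)"
proof
  fix T assume "T \<in> triangle_pairs algebra_pairs"
  then obtain a b c where
    "T = case_sum (Delta (lincomb d a (adj_mat R)) (lincomb d b (adj_mat R)) (lincomb d c (adj_mat R)))
      (Delta (lincomb d a (adj_mat S)) (lincomb d b (adj_mat S)) (lincomb d c (adj_mat S)))"
    by (auto simp: triangle_pairs_def algebra_pairs_def)
  then show "T \<in> cspan (triangle_pair ` triples d)"
    by (simp only: Delta_lincomb case_sum_linear_combination) (intro cspan_sum cspan_base imageI)
qed

lemma star_pairs_subset: "star_pairs algebra_pairs \<subseteq> cspan (star_pair ` triples d)"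
proof
  fix T assume "T \<in> star_pairs algebra_pairs"
  then obtain a b c where
    "T = case_sum (Upsilon (lincomb d a E) (lincomb d b E) (lincomb d c E))
      (Upsilon (lincomb d a E') (lincomb d b E') (lincomb d c E'))"
    by (auto simp: star_pairs_def algebra_pairs_eq_E)
  then show "T \<in> cspan (star_pair ` triples d)"
    by (simp only: Upsilon_lincomb case_sum_linear_combination) (intro cspan_sum cspan_base imageI)
qed

lemma star_pair_image_subset: "star_pair ` triples d \<subseteq> star_pairs algebra_pairs"
  by (auto simp: Upsilon_family_def intro!: star_pairsI E_pair)

lemma triangle_pair_image_subset: "triangle_pair ` triples d \<subseteq> triangle_pairs algebra_pairs"
  by (auto simp: Delta_family_def intro!: triangle_pairsI adj_mat_pair)

sublocale star_triangle_pair algebra_pairs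
proof
  have rel_form:
    "\<exists>c. M = (\<lambda>x y. c (X.rel x y)) \<and> M' = (\<lambda>x y. c (Y.rel x y))" if "(M, M') \<in> algebra_pairs"
    for M M'
    using that by (auto simp: algebra_pairs_def X.lincomb_adj_mat Y.lincomb_adj_mat)
  show "M x y = M y x" "M' x' y' = M' y' x'" if "(M, M') \<in> algebra_pairs" for M M' x y x' y'
    using rel_form[OF that] X.rel_commute Y.rel_commute by auto
  have "X.rel x x = 0" "Y.rel y y = 0" for x y by (simp_all add: X.rel_eq_0_iff Y.rel_eq_0_iff)
  then show "\<exists>m. (\<forall>x. M x x = m) \<and> (\<forall>x. M' x x = m)" if "(M, M') \<in> algebra_pairs" for M M'
    using rel_form[OF that] by auto
  have "triangle_pairs algebra_pairs \<subseteq> cspan (triangle_pair ` triples d)" by (rule triangle_pairs_subset)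
  also have "\<dots> \<subseteq> cspan (star_pair ` triples d)" using triangle_pair_mem by (intro cspan_minimal) blast
  also have "\<dots> \<subseteq> cspan (star_pairs algebra_pairs)"
    using star_pair_image_subset by (intro cspan_minimal) (blast intro: cspan_base)
  finally show "triangle_pairs algebra_pairs \<subseteq> cspan (star_pairs algebra_pairs)" .
  have "star_pairs algebra_pairs \<subseteq> cspan (star_pair ` triples d)" by (rule star_pairs_subset)
  also have "\<dots> \<subseteq> cspan (triangle_pair ` triples d)" using star_pair_mem by (intro cspan_minimal) blast
  also have "\<dots> \<subseteq> cspan (triangle_pairs algebra_pairs)"
    using triangle_pair_image_subset by (intro cspan_minimal) (blast intro: cspan_base)
  finally show "star_pairs algebra_pairs \<subseteq> cspan (triangle_pairs algebra_pairs)" .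
qed (use ones_pair id_pair algebra_pairs_mmult algebra_pairs_column_sum in auto)

end

lemma (in assoc_scheme) linear_map_lincomb:
  fixes \<kappa> :: "'x mat \<Rightarrow> 'y mat"
  assumes add: "\<And>M N. M \<in> bose_mesner d R \<Longrightarrow> N \<in> bose_mesner d R \<Longrightarrow>
      \<kappa> (\<lambda>x y. M x y + N x y) = (\<lambda>x y. \<kappa> M x y + \<kappa> N x y)"
    and scale: "\<And>c M. M \<in> bose_mesner d R \<Longrightarrow> \<kappa> (\<lambda>x y. c * M x y) = (\<lambda>x y. c * \<kappa> M x y)"
    and F: "\<And>i. i \<le> n \<Longrightarrow> F i \<in> bose_mesner d R"
  shows "\<kappa> (lincomb n c F) = lincomb n c (\<lambda>i. \<kappa> (F i))"
proof -
  have "lincomb n c F \<in> bose_mesner d R \<and> \<kappa> (lincomb n c F) = lincomb n c (\<lambda>i. \<kappa> (F i))"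
    using F
  proof (induction n)
    case 0
    then show ?case using bose_mesner_scale[of "F 0" "c 0"] scale[of "F 0" "c 0"]
      by (simp add: lincomb_def)
  next
    case (Suc n)
    have lincomb_Suc: "lincomb (Suc n) c G = (\<lambda>x y. lincomb n c G x y + c (Suc n) * G (Suc n) x y)"
      for G :: "nat \<Rightarrow> 'z mat"
      by (simp add: lincomb_def)
    show ?case
      unfolding lincomb_Suc
      using Suc bose_mesner_scale[of "F (Suc n)"] scale[of "F (Suc n)"]
      by (simp add: add bose_mesner_add)
  qed
  then show ?thesis ..
qed

theorem mainTheorem1:
  fixes d :: nat
    and R :: "nat \<Rightarrow> ('x::finite \<times> 'x) set" and S :: "nat \<Rightarrow> ('y::finite \<times> 'y) set"
    and E :: "nat \<Rightarrow> 'x mat" and E' :: "nat \<Rightarrow> 'y mat"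
    and \<kappa> :: "'x mat \<Rightarrow> 'y mat"
    and V :: "'v set" and Ed :: "'e set" and ends :: "'e \<Rightarrow> 'v \<times> 'v"
    and w :: "'e \<Rightarrow> 'x mat"
  assumes schemeX: "sym_assoc_scheme d R"
    and schemeY: "sym_assoc_scheme d S"
    and idemX: "prim_idempotents d R E"
    and idemY: "prim_idempotents d S E'"
    and etrX: "exactly_triply_regular d R"
    and etrY: "exactly_triply_regular d S"
    and same_dw: "\<forall>i\<le>d. \<forall>j\<le>d. \<forall>k\<le>d. \<forall>r\<le>d. \<forall>s\<le>d. \<forall>t\<le>d.
                   dw_sigma d R E i j k r s t = dw_sigma d S E' i j k r s t"
    and kappa_add: "\<forall>M\<in>bose_mesner d R. \<forall>N\<in>bose_mesner d R.
                      \<kappa> (\<lambda>x y. M x y + N x y) = (\<lambda>x y. \<kappa> M x y + \<kappa> N x y)"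
    and kappa_scale: "\<forall>c. \<forall>M\<in>bose_mesner d R. \<kappa> (\<lambda>x y. c * M x y) = (\<lambda>x y. c * \<kappa> M x y)"
    and kappa_A: "\<forall>i\<le>d. \<kappa> (adj_mat R i) = adj_mat S i"
    and graph: "finite_graph V Ed ends"
    and conn: "graph_connected V Ed ends"
    and planar: "planar_graph V Ed ends"
    and w_in: "\<forall>e\<in>Ed. w e \<in> bose_mesner d R"
  shows "scaffold0 V Ed ends w = scaffold0 V Ed ends (\<kappa> \<circ> w)"
proof -
  interpret X: etr_scheme d R E using schemeX idemX etrX by unfold_locales
  interpret Y: etr_scheme d S E' using schemeY idemY etrY by unfold_locales
  interpret dw_pair d R E S E'
    by unfold_locales (use same_dw in \<open>auto simp: X.sigma_def Y.sigma_def\<close>)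
  show ?thesis
  proof (rule scaffold0_eq_of_planar[OF graph planar])
    fix e assume "e \<in> Ed"
    then obtain c where "w e = lincomb d c (adj_mat R)" using w_in bose_mesner_iff_lincomb by blast
    moreover have "\<kappa> (lincomb d c (adj_mat R)) = lincomb d c (\<lambda>i. \<kappa> (adj_mat R i))"
      using kappa_add kappa_scale X.adj_mat_mem by (intro X.linear_map_lincomb) auto
    moreover have "\<dots> = lincomb d c (adj_mat S)" using kappa_A by (simp add: lincomb_def)
    ultimately show "(w e, (\<kappa> \<circ> w) e) \<in> algebra_pairs" by (auto simp: algebra_pairs_def)
  qed
qed

end
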